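(* Under the simple Hopf pair assumption of the context, assume $\sigma_{\mathrm H,c}^2=\lim_{\alpha\to\alpha_{\mathrm c}^-}\sigma_{\mathrm H}^2>0$, where $\sigma_{\mathrm H}=\|B^\top\boldsymbol{w}_{\mathrm H}\|_2\ge0$. Let $\boldsymbol{x}=\boldsymbol{x}^*(\alpha)+\boldsymbol{z}$ with $\boldsymbol{z}\sim\mathcal{N}(\boldsymbol{0},C(\alpha))$, and let $\boldsymbol{u}_{\mathrm H}=G_1\boldsymbol{p}_{\mathrm c}+G_2\boldsymbol{q}_{\mathrm c}$ with $G_1,G_2$ independent standard normal random variables, where $\boldsymbol{p}_{\mathrm c}=\operatorname{Re}\boldsymbol{v}_{\mathrm H,c}$, $\boldsymbol{q}_{\mathrm c}=\operatorname{Im}\boldsymbol{v}_{\mathrm H,c}$ and $\boldsymbol{v}_{\mathrm H,c}=\lim_{\alpha\to\alpha_{\mathrm c}^-}\boldsymbol{v}_{\mathrm H}(\alpha)$. Then, as $\alpha\to\alpha_{\mathrm c}^-$, in distribution, $$\frac{\sqrt\eta}{\sigma_{\mathrm H}}\big(\boldsymbol{x}-\boldsymbol{x}^*(\alpha)\big)\xrightarrow{\mathrm d}\boldsymbol{u}_{\mathrm H}.$$ Consequently, $$\frac{\sqrt\eta}{\sigma_{\mathrm H}}P\boldsymbol{x}\xrightarrow{\mathrm d}P\boldsymbol{u}_{\mathrm H}\qquad\text{and}\qquad\frac{\sqrt\eta}{\sigma_{\mathrm H}}\bar x\xrightarrow{\mathrm d}\frac1N\boldsymbol{1}^\top\boldsymbol{u}_{\mathrm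 H}.$$
   Context: Setting. $N\ge2$. Consider the It\^o SDE $\mathrm d\boldsymbol{x}=F(\boldsymbol{x};\alpha)\,\mathrm dt+B\,\mathrm d\boldsymbol{W}$ in $\mathbb{R}^N$, with $B\in\mathbb{R}^{N\times m}$ constant, $\boldsymbol{W}$ an $m$-dimensional standard Wiener process, and $F$ sufficiently smooth in $(\boldsymbol{x},\alpha)$ ($C^2$ in a neighborhood of the equilibrium branch, including its endpoint at $\alpha_{\mathrm c}$, suffices). $\boldsymbol{x}^*(\alpha)$ is a branch of equilibria, asymptotically stable for $\alpha<\alpha_{\mathrm c}$; $M(\alpha)=-\frac{\partial F}{\partial\boldsymbol{x}}\big|_{\boldsymbol{x}=\boldsymbol{x}^*(\alpha)}$; $C(\alpha)$ solves $MC+CM^\top=BB^\top$. Simple Hopf pair assumption. $\boldsymbol{x}^*(\alpha)$ has a finite limit $\boldsymbol{x}^*_{\mathrm c}$ as $\alpha\to\alpha_{\mathrm c}^-$. For $\alpha<\alpha_{\mathrm c}$ close to $\alpha_{\mathrm c}$, the real matrix $M(\alpha)$ is diagonalizable over $\mathbb{C}$ and has a simple complex-conjugate eigenvalue pair $\lambda_\pm(\alpha)=\eta(\alpha)\pm\mathrm i\,\Omega(\alpha)$ with $\eta(\alpha)>0$, $\eta(\alpha)\to0$, $\Omega(\alpha)\to\Omega_{\mathrm c}>0$; all other eigenvalues satisfy $\operatorname{Re}\lambda_k(\alpha)\ge\delta>0$ with $\delta$ independent of $\alpha$. $\boldsymbol{v}_{\mathrm H},\overline{\boldsymbol{v}_{\mathrm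 H}}$ are right eigenvectors for $\lambda_+,\lambda_-$ and $\boldsymbol{w}_{\mathrm H},\overline{\boldsymbol{w}_{\mathrm H}}$ the corresponding left eigenvectors ($\boldsymbol{w}_{\mathrm H}^\top M=\lambda_+\boldsymbol{w}_{\mathrm H}^\top$), with $\|\boldsymbol{v}_{\mathrm H}\|_2=1$, $\boldsymbol{w}_{\mathrm H}^\top\boldsymbol{v}_{\mathrm H}=1$, $\boldsymbol{w}_{\mathrm H}^\top\overline{\boldsymbol{v}_{\mathrm H}}=0$ (plain transpose, no conjugation). $\boldsymbol{v}_{\mathrm H}$ and $\boldsymbol{w}_{\mathrm H}$ have finite limits as $\alpha\to\alpha_{\mathrm c}^-$. Notation: $P=I-\frac1N\boldsymbol{1}\boldsymbol{1}^\top$, $\bar x=N^{-1}\sum_ix_i$. *)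

theory Defs
  imports "HOL-Probability.Probability"
begin

text \<open>
  The state space is \<open>real ^ 'n\<close> and the noise space \<open>real ^ 'm\<close>, so that the number of states is
  \<open>CARD('n)\<close>. A parameter-dependent vector field is a curried function \<open>F x \<alpha>\<close>.
\<close>

text \<open>Twice continuously differentiable, with the derivatives taken in the spaces of bounded linear
  maps (hence continuity of \<open>f''\<close> is continuity in operator norm). Meant for open \<open>U\<close>.\<close>

definition C2_on :: "('a::real_normed_vector \<Rightarrow> 'b::real_normed_vector) \<Rightarrow> 'a set \<Rightarrow> bool" where
  "C2_on f U \<longleftrightarrow>
     (\<exists>(f' :: 'a \<Rightarrow> 'a \<Rightarrow>\<^sub>L 'b) (f'' :: 'a \<Rightarrow> 'a \<Rightarrow>\<^sub>L 'a \<Rightarrow>\<^sub>L 'b).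
        (\<forall>x\<in>U. (f has_derivative blinfun_apply (f' x)) (at x)) \<and>
        (\<forall>x\<in>U. (f' has_derivative blinfun_apply (f'' x)) (at x)) \<and>
        continuous_on U f'')"

definition ode_solution :: "('a::real_normed_vector \<Rightarrow> 'a) \<Rightarrow> real set \<Rightarrow> (real \<Rightarrow> 'a) \<Rightarrow> bool" where
  "ode_solution f I y \<longleftrightarrow> (\<forall>t\<in>I. (y has_vector_derivative f (y t)) (at t within I))"

text \<open>Equilibrium that is Lyapunov stable and locally attractive. Stability is required of solutions on
  every bounded interval \<open>[0, T)\<close>, so that solutions that might cease to exist are covered.\<close>

definition asymptotically_stable_equilibrium ::
    "('a::real_normed_vector \<Rightarrow> 'a) \<Rightarrow> 'a \<Rightarrow> bool" where
  "asymptotically_stable_equilibrium f x0 \<longleftrightarrow>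
     f x0 = 0 \<and>
     (\<forall>\<epsilon>>0. \<exists>d>0. \<forall>T>0. \<forall>y. ode_solution f {0..<T} y \<and> dist (y 0) x0 < d \<longrightarrow>
        (\<forall>t\<in>{0..<T}. dist (y t) x0 < \<epsilon>)) \<and>
     (\<exists>d>0. \<forall>y. ode_solution f {0..} y \<and> dist (y 0) x0 < d \<longrightarrow> (y \<longlongrightarrow> x0) at_top)"

definition complex_matrix :: "real ^ 'n ^ 'm \<Rightarrow> complex ^ 'n ^ 'm" where
  "complex_matrix A = map_matrix complex_of_real A"

definition Re_vec :: "complex ^ 'n \<Rightarrow> real ^ 'n" where
  "Re_vec v = (\<chi> i. Re (v $ i))"

definition Im_vec :: "complex ^ 'n \<Rightarrow> real ^ 'n" where
  "Im_vec v = (\<chi> i. Im (v $ i))"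

definition cnj_vec :: "complex ^ 'n \<Rightarrow> complex ^ 'n" where
  "cnj_vec v = (\<chi> i. cnj (v $ i))"

definition diagonalizable :: "'a::field ^ 'n ^ 'n \<Rightarrow> bool" where
  "diagonalizable A \<longleftrightarrow>
     (\<exists>S D :: 'a ^ 'n ^ 'n. invertible S \<and> (\<forall>i j. i \<noteq> j \<longrightarrow> D $ i $ j = 0) \<and> A = S ** D ** matrix_inv S)"

text \<open>The characteristic polynomial, as the determinant of \<open>X I - A\<close> over the polynomial ring.\<close>

definition charpoly :: "'a::field ^ 'n ^ 'n \<Rightarrow> 'a poly" where
  "charpoly A = det (mat [:0, 1:] - map_matrix (\<lambda>c. [:c:]) A)"

definition right_eigenvector :: "'a::field ^ 'n ^ 'n \<Rightarrow> 'a ^ 'n \<Rightarrow> 'a \<Rightarrow> bool" where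
  "right_eigenvector A v k \<longleftrightarrow> v \<noteq> 0 \<and> A *v v = k *s v"

definition left_eigenvector :: "'a::field ^ 'n ^ 'n \<Rightarrow> 'a ^ 'n \<Rightarrow> 'a \<Rightarrow> bool" where
  "left_eigenvector A w k \<longleftrightarrow> w \<noteq> 0 \<and> w v* A = k *s w"

definition eigenvalue :: "'a::field ^ 'n ^ 'n \<Rightarrow> 'a \<Rightarrow> bool" where
  "eigenvalue A k \<longleftrightarrow> (\<exists>v. right_eigenvector A v k)"

text \<open>Simplicity refers to the algebraic multiplicity.\<close>

definition simple_eigenvalue :: "'a::field ^ 'n ^ 'n \<Rightarrow> 'a \<Rightarrow> bool" where
  "simple_eigenvalue A k \<longleftrightarrow> eigenvalue A k \<and> order k (charpoly A) = 1"

text \<open>The one-dimensional normal law with mean \<open>m\<close> and variance \<open>v \<ge> 0\<close>; it is the Dirac measure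
  at \<open>m\<close> if \<open>v = 0\<close>.\<close>

definition normal_law :: "real \<Rightarrow> real \<Rightarrow> real measure" where
  "normal_law m v =
     (if v = 0 then return borel m else density lborel (\<lambda>x. ennreal (normal_density m (sqrt v) x)))"

text \<open>\<open>X\<close> is a normal random vector with mean \<open>\<mu>\<close> and covariance matrix \<open>S\<close>, which may be singular
  (so there need not be a density): every linear functional of \<open>X\<close> has the corresponding normal law.
  The condition \<open>0 \<le> t \<bullet> (S *v t)\<close> is needed because \<^const>\<open>normal_density\<close> depends only on the square
  of its second argument and so does not reject a negative variance.\<close>

definition normal_random_vector ::
    "'w measure \<Rightarrow> ('w \<Rightarrow> real ^ 'n) \<Rightarrow> real ^ 'n \<Rightarrow> real ^ 'n ^ 'n \<Rightarrow> bool" where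
  "normal_random_vector W X \<mu> S \<longleftrightarrow>
     prob_space W \<and> X \<in> borel_measurable W \<and> transpose S = S \<and>
     (\<forall>t. 0 \<le> t \<bullet> (S *v t) \<and>
          distr W borel (\<lambda>\<omega>. t \<bullet> X \<omega>) = normal_law (t \<bullet> \<mu>) (t \<bullet> (S *v t)))"

text \<open>Convergence in distribution along an arbitrary filter, by bounded continuous test functions.
  Each \<open>X i\<close> lives on its own probability space \<open>W i\<close>, and the limit on yet another one. The library's
  \<^const>\<open>weak_conv_m\<close> only covers sequences of measures on the real line.\<close>

definition converges_in_distribution ::
    "('i \<Rightarrow> 'w measure) \<Rightarrow> ('i \<Rightarrow> 'w \<Rightarrow> 'a::topological_space) \<Rightarrow>
     'v measure \<Rightarrow> ('v \<Rightarrow> 'a) \<Rightarrow> 'i filter \<Rightarrow> bool" where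
  "converges_in_distribution W X V Y \<F> \<longleftrightarrow>
     (\<forall>f :: 'a \<Rightarrow> real. continuous_on UNIV f \<and> bounded (range f) \<longrightarrow>
        ((\<lambda>i. \<integral>\<omega>. f (X i \<omega>) \<partial>W i) \<longlongrightarrow> (\<integral>\<omega>. f (Y \<omega>) \<partial>V)) \<F>)"

definition all_ones :: "real ^ 'n" where
  "all_ones = (\<chi> i. 1)"

text \<open>\<open>I - (1/N) 1 1\<^sup>T\<close>, the projection that removes the average over the components.\<close>

definition centering_matrix :: "real ^ 'n ^ 'n" where
  "centering_matrix = mat 1 - (1 / real CARD('n)) *\<^sub>R (\<chi> i j. all_ones $ i * all_ones $ j)"

definition component_mean :: "real ^ 'n \<Rightarrow> real" where
  "component_mean x = (\<Sum>i\<in>UNIV. x $ i) / real CARD('n)"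

end

theory Submission
  imports Defs
begin

text \<open>
  Along the critical pair the Lyapunov equation is solved explicitly by the quadratic forms of
  \<open>C\<close> at the real and imaginary part of \<open>w\<^sub>H\<close>, and \<open>\<eta> C / \<sigma>\<^sub>H\<^sup>2\<close> converges there to \<open>p p\<^sup>T + q q\<^sup>T\<close>. On the complementary
  invariant subspace the eigenvectors may degenerate as \<open>\<alpha> \<rightarrow> \<alpha>\<^sub>c\<close>, but the determinant of the Lyapunov
  operator is a product of eigenvalue sums, hence stays away from zero; since \<open>M\<close> has a limit, that part of
  \<open>C\<close> stays bounded and is killed by the factor \<open>\<eta>\<close>. Convergence of the covariances gives convergence of
  the characteristic functions, and a multivariate continuity theorem (bounded second moments,
  Stone--Weierstrass for trigonometric polynomials) turns this into convergence in distribution.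
\<close>

section \<open>Convergence in distribution of random vectors\<close>

text \<open>The obstacle is that the matrices diagonalizing \<open>M \<alpha>\<close> carry no
  bound: apart from \<open>vH\<close> and \<open>wH\<close>, no eigenvector is assumed to converge.
  Estimates must rest on eigenvalues alone, hence a determinant instead of a change of basis. No
  basis of the complementary subspace is chosen either: with \<open>P\<close> the real spectral
  projection of the critical pair, \<open>M + \<delta> P\<close> has all eigenvalues in the half
  plane \<open>Re \<ge> \<delta>\<close> and is intertwined with \<open>M\<close> by
  \<open>I - P\<close>. The shape of the limit comes from two scalars: \<open>w\<^sup>T C w\<close>
  is multiplied by 2 \<lambda>, which tends to the nonzero \<open>2 \<i> \<Omega>c\<close>, so it
  stays bounded. Hence, to leading order, the forms of \<open>C\<close> at \<open>Re w\<close> and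
  \<open>Im w\<close> both equal \<open>\<sigma>\<^sup>2 / (4 \<eta>)\<close> and the mixed term is
  negligible. Since \<open>P\<^sup>T t = 2 (t \<bullet> Re v) Re w - 2 (t \<bullet> Im v) Im
  w\<close>, the factor 4 cancels and
  \<open>(t \<bullet> Re v)\<^sup>2 + (t \<bullet> Im v)\<^sup>2\<close> remains. Everything is
  tested on one vector \<open>t\<close> at a time, because normal laws with singular covariance are
  given by their linear functionals.\<close>

inductive trig_polynomial :: "('a::real_inner \<Rightarrow> real) \<Rightarrow> bool" where
  cos: "trig_polynomial (\<lambda>x. cos (t \<bullet> x))"
| sin: "trig_polynomial (\<lambda>x. sin (t \<bullet> x))"
| add: "trig_polynomial f \<Longrightarrow> trig_polynomial g \<Longrightarrow> trig_polynomial (\<lambda>x. f x + g x)"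
| cmult: "trig_polynomial f \<Longrightarrow> trig_polynomial (\<lambda>x. c * f x)"

lemma trig_polynomial_const: "trig_polynomial (\<lambda>x. c)"
  using trig_polynomial.cmult[OF trig_polynomial.cos[of 0], of c] by simp

lemma trig_polynomial_sum:
  "(\<And>i. i \<in> I \<Longrightarrow> trig_polynomial (f i)) \<Longrightarrow> trig_polynomial (\<lambda>x. \<Sum>i\<in>I. f i x)"
  by (induction I rule: infinite_finite_induct) (auto intro: trig_polynomial_const trig_polynomial.add)

text \<open>The product-to-sum formulas only shift frequencies, so closure under linear combinations
  already yields closure under products. With products kept out of the inductive definition,
  expectations of its members reduce to those of single cosines and sines.\<close>

lemma trig_polynomial_mult_cos_sin:
  assumes "trig_polynomial f"
  shows "trig_polynomial (\<lambda>x. f x * cos (t \<bullet> x))" "trig_polynomial (\<lambda>x. f x * sin (t \<bullet> x))"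
  using assms
proof (induction rule: trig_polynomial.induct)
  case (cos s)
  have 1: "cos (s \<bullet> x) * cos (t \<bullet> x) = (1/2) * cos ((s - t) \<bullet> x) + (1/2) * cos ((s + t) \<bullet> x)"
    and 2: "cos (s \<bullet> x) * sin (t \<bullet> x) = (1/2) * sin ((s + t) \<bullet> x) + (-1/2) * sin ((s - t) \<bullet> x)" for x
    by (simp_all add: inner_add_left inner_diff_left cos_add cos_diff sin_add sin_diff field_simps)
  show "trig_polynomial (\<lambda>x. cos (s \<bullet> x) * cos (t \<bullet> x))" "trig_polynomial (\<lambda>x. cos (s \<bullet> x) * sin (t \<bullet> x))"
    unfolding 1 2 by (intro trig_polynomial.intros)+
next
  case (sin s)
  have 1: "sin (s \<bullet> x) * cos (t \<bullet> x) = (1/2) * sin ((s + t) \<bullet> x) + (1/2) * sin ((s - t) \<bullet> x)"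
    and 2: "sin (s \<bullet> x) * sin (t \<bullet> x) = (1/2) * cos ((s - t) \<bullet> x) + (-1/2) * cos ((s + t) \<bullet> x)" for x
    by (simp_all add: inner_add_left inner_diff_left cos_add cos_diff sin_add sin_diff field_simps)
  show "trig_polynomial (\<lambda>x. sin (s \<bullet> x) * cos (t \<bullet> x))" "trig_polynomial (\<lambda>x. sin (s \<bullet> x) * sin (t \<bullet> x))"
    unfolding 1 2 by (intro trig_polynomial.intros)+
qed (auto simp: distrib_right mult.assoc intro: trig_polynomial.intros)

lemma trig_polynomial_mult:
  assumes "trig_polynomial g" "trig_polynomial f"
  shows "trig_polynomial (\<lambda>x. f x * g x)"
  using assms(1)
proof (induction rule: trig_polynomial.induct)
  case (cmult g c)
  then show ?case using trig_polynomial.cmult[of "\<lambda>x. f x * g x" c] by (simp add: ac_simps)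
qed (auto simp: distrib_left intro: trig_polynomial.intros trig_polynomial_mult_cos_sin assms(2))

lemma bounded_measurable_trig_polynomial:
  fixes f :: "'a::euclidean_space \<Rightarrow> real"
  assumes "trig_polynomial f"
  shows "f \<in> borel_measurable borel \<and> (\<exists>K. \<forall>x. \<bar>f x\<bar> \<le> K)"
  using assms
proof (induction rule: trig_polynomial.induct)
  case (cos t)
  then show ?case by (auto intro!: exI[of _ 1])
next
  case (sin t)
  then show ?case by (auto intro!: exI[of _ 1])
next
  case (add f g)
  then obtain K L where "\<And>x. \<bar>f x\<bar> \<le> K" "\<And>x. \<bar>g x\<bar> \<le> L" by auto
  then have "\<bar>f x + g x\<bar> \<le> K + L" for x by (meson abs_triangle_ineq add_mono order_trans)
  with add show ?case by auto
next
  case (cmult f c)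
  then obtain K where "\<And>x. \<bar>f x\<bar> \<le> K" by auto
  then have "\<bar>c * f x\<bar> \<le> \<bar>c\<bar> * K" for x by (simp add: abs_mult mult_left_mono)
  with cmult show ?case by auto
qed

lemma (in prob_space) integrable_trig_polynomial:
  fixes f :: "'b::euclidean_space \<Rightarrow> real"
  assumes "trig_polynomial f" and [measurable]: "X \<in> borel_measurable M"
  shows "integrable M (\<lambda>\<omega>. f (X \<omega>))"
proof -
  from bounded_measurable_trig_polynomial[OF assms(1)] obtain K
    where [measurable]: "f \<in> borel_measurable borel" and K: "\<And>x. \<bar>f x\<bar> \<le> K" by auto
  show ?thesis by (rule integrable_const_bound[of _ K]) (auto simp: K)
qed

lemma tendsto_expectation_trig_polynomial:
  fixes X :: "'i \<Rightarrow> 'w \<Rightarrow> 'a::euclidean_space" and Y :: "'v \<Rightarrow> 'a"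
  assumes X: "\<forall>\<^sub>F i in F. prob_space (W i) \<and> X i \<in> borel_measurable (W i)"
    and V: "prob_space V" and Y: "Y \<in> borel_measurable V"
    and cos: "\<And>t. ((\<lambda>i. \<integral>\<omega>. cos (t \<bullet> X i \<omega>) \<partial>W i) \<longlongrightarrow> (\<integral>\<omega>. cos (t \<bullet> Y \<omega>) \<partial>V)) F"
    and sin: "\<And>t. ((\<lambda>i. \<integral>\<omega>. sin (t \<bullet> X i \<omega>) \<partial>W i) \<longlongrightarrow> (\<integral>\<omega>. sin (t \<bullet> Y \<omega>) \<partial>V)) F"
    and f: "trig_polynomial f"
  shows "((\<lambda>i. \<integral>\<omega>. f (X i \<omega>) \<partial>W i) \<longlongrightarrow> (\<integral>\<omega>. f (Y \<omega>) \<partial>V)) F"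
  using f
proof (induction rule: trig_polynomial.induct)
  case (add f g)
  \<comment> \<open>Additivity needs integrability, which is available only for those
    \<open>i\<close> where \<open>W i\<close> is a probability space; hence an eventual
    equality.\<close>
  have *: "\<forall>\<^sub>F i in F. (\<integral>\<omega>. f (X i \<omega>) \<partial>W i) + (\<integral>\<omega>. g (X i \<omega>) \<partial>W i) = (\<integral>\<omega>. f (X i \<omega>) + g (X i \<omega>) \<partial>W i)"
    using X
  proof eventually_elim
    case (elim i)
    then interpret prob_space "W i" by simp
    show ?case
      using elim integrable_trig_polynomial[OF add.hyps(1), of "X i"] integrable_trig_polynomial[OF add.hyps(2), of "X i"]
      by simp
  qed
  have "(\<integral>\<omega>. f (Y \<omega>) \<partial>V) + (\<integral>\<omega>. g (Y \<omega>) \<partial>V) = (\<integral>\<omega>. f (Y \<omega>) + g (Y \<omega>) \<partial>V)"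
    using prob_space.integrable_trig_polynomial[OF V add.hyps(1) Y] prob_space.integrable_trig_polynomial[OF V add.hyps(2) Y]
    by simp
  then show ?case using Lim_transform_eventually[OF tendsto_add[OF add.IH] *] by simp
qed (auto intro!: cos sin tendsto_intros)

text \<open>The bridge from the algebraic polynomials of Stone-Weierstrass: a linear functional of
  the vector of sines is a sum of sines, and the rest is the algebra structure.\<close>

lemma trig_polynomial_real_polynomial_function_sin:
  fixes p :: "'a::euclidean_space \<Rightarrow> real"
  assumes "real_polynomial_function p"
  shows "trig_polynomial (\<lambda>x. p (\<Sum>b\<in>Basis. sin (c * (x \<bullet> b)) *\<^sub>R b))"
  using assms
proof (induction rule: real_polynomial_function.induct)
  case (linear f)
  then interpret bounded_linear f .
  have "f (\<Sum>b\<in>Basis. sin (c * (x \<bullet> b)) *\<^sub>R b) = (\<Sum>b\<in>Basis. f b * sin ((c *\<^sub>R b) \<bullet> x))" for x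
    by (simp add: sum scaleR inner_commute mult.commute)
  then show ?case by (simp only:) (intro trig_polynomial_sum trig_polynomial.intros)
qed (auto intro: trig_polynomial_const trig_polynomial.add trig_polynomial_mult)

text \<open>On the box \<open>\<bar>x \<bullet> b\<bar> \<le> L\<close>, \<open>f\<close> is a continuous function of the sines of the scaled coordinates, to which
  Stone--Weierstrass applies on a cube. Composed with the sines, the approximation stays
  bounded off the box, where the error is absorbed by the quadratic term.\<close>

lemma trig_polynomial_approximation:
  fixes f :: "'a::euclidean_space \<Rightarrow> real"
  assumes f: "continuous_on UNIV f" and B: "\<And>x. \<bar>f x\<bar> \<le> B" and e: "e > 0" and L: "L > 0"
  obtains g where "trig_polynomial g" "\<And>x. \<bar>f x - g x\<bar> \<le> e + 2 * B / L\<^sup>2 * (norm x)\<^sup>2"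
proof -
  \<comment> \<open>This scaling sends \<open>[-L, L]\<close> onto the interval from -pi/2 to pi/2,
    where \<open>arcsin\<close> inverts \<open>sin\<close>; thus \<open>R (S x) = x\<close> on the
    box.\<close>
  define c where "c = pi / (2 * L)"
  have c: "c > 0" using L by (simp add: c_def)
  define S :: "'a \<Rightarrow> 'a" where "S = (\<lambda>x. \<Sum>b\<in>Basis. sin (c * (x \<bullet> b)) *\<^sub>R b)"
  define R :: "'a \<Rightarrow> 'a" where "R = (\<lambda>y. \<Sum>b\<in>Basis. (arcsin (y \<bullet> b) / c) *\<^sub>R b)"
  have S_inner: "S x \<bullet> b = sin (c * (x \<bullet> b))" if "b \<in> Basis" for x b
    using that by (simp add: S_def)
  have S_box: "S x \<in> cbox (- One) One" for x
    by (auto simp: mem_box S_inner)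
  have "continuous_on (cbox (- One) One) R"
    unfolding R_def by (intro continuous_intros) (use c in \<open>auto simp: mem_box\<close>)
  then have "continuous_on (cbox (- One) One) (f \<circ> R)"
    by (intro continuous_on_compose continuous_on_subset[OF f]) auto
  from Stone_Weierstrass_real_polynomial_function[OF compact_cbox this e] obtain p
    where p: "real_polynomial_function p" and pe: "\<And>y. y \<in> cbox (- One) One \<Longrightarrow> \<bar>f (R y) - p y\<bar> < e"
    by (auto simp: o_def)
  have RS: "\<bar>f x - f (R (S x))\<bar> \<le> 2 * B / L\<^sup>2 * (norm x)\<^sup>2" for x
  proof (cases "\<forall>b\<in>Basis. \<bar>x \<bullet> b\<bar> \<le> L")
    case True
    have "arcsin (sin (c * (x \<bullet> b))) = c * (x \<bullet> b)" if "b \<in> Basis" for b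
    proof -
      have "c * \<bar>x \<bullet> b\<bar> \<le> c * L" using True that c by (intro mult_left_mono) auto
      also have "c * L = pi / 2" using L by (simp add: c_def)
      finally have "\<bar>c * (x \<bullet> b)\<bar> \<le> pi / 2" using c by (simp add: abs_mult)
      then show ?thesis by (intro arcsin_sin) auto
    qed
    then have "R (S x) = (\<Sum>b\<in>Basis. (x \<bullet> b) *\<^sub>R b)"
      unfolding R_def using c by (intro sum.cong) (auto simp: S_inner)
    then have "R (S x) = x" by (simp add: euclidean_representation)
    moreover have "B \<ge> 0" using B[of 0] by linarith
    ultimately show ?thesis using L by simp
  next
    case False
    then obtain b where b: "b \<in> Basis" "\<bar>x \<bullet> b\<bar> > L" by auto
    have "L \<le> norm x" using b Basis_le_norm[OF b(1), of x] by linarith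
    then have "L\<^sup>2 \<le> (norm x)\<^sup>2" using L by (intro power_mono) auto
    moreover have "B \<ge> 0" using B[of 0] by linarith
    ultimately have "2 * B * 1 \<le> 2 * B * ((norm x)\<^sup>2 / L\<^sup>2)" using L by (intro mult_left_mono) auto
    then show ?thesis using B[of x] B[of "R (S x)"] by (simp add: abs_le_iff)
  qed
  show ?thesis
  proof
    show "trig_polynomial (\<lambda>x. p (S x))"
      unfolding S_def by (rule trig_polynomial_real_polynomial_function_sin[OF p])
    show "\<bar>f x - p (S x)\<bar> \<le> e + 2 * B / L\<^sup>2 * (norm x)\<^sup>2" for x
      using RS[of x] pe[OF S_box[of x]] by linarith
  qed
qed

section \<open>Continuity theorem for characteristic functions\<close>

lemma (in prob_space) expectation_approximation:
  fixes f g :: "'b::euclidean_space \<Rightarrow> real"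
  assumes [measurable]: "f \<in> borel_measurable borel" and B: "\<And>x. \<bar>f x\<bar> \<le> B"
    and g: "trig_polynomial g" and fg: "\<And>x. \<bar>f x - g x\<bar> \<le> e + c * (norm x)\<^sup>2"
    and X[measurable]: "X \<in> borel_measurable M"
    and sq: "integrable M (\<lambda>\<omega>. (norm (X \<omega>))\<^sup>2)" "(\<integral>\<omega>. (norm (X \<omega>))\<^sup>2 \<partial>M) \<le> K" and c: "c \<ge> 0"
  shows "\<bar>(\<integral>\<omega>. f (X \<omega>) \<partial>M) - (\<integral>\<omega>. g (X \<omega>) \<partial>M)\<bar> \<le> e + c * K"
proof -
  have f: "integrable M (\<lambda>\<omega>. f (X \<omega>))" by (rule integrable_const_bound[of _ B]) (auto simp: B)
  have g: "integrable M (\<lambda>\<omega>. g (X \<omega>))" by (rule integrable_trig_polynomial[OF g X])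
  have "\<bar>(\<integral>\<omega>. f (X \<omega>) \<partial>M) - (\<integral>\<omega>. g (X \<omega>) \<partial>M)\<bar> = \<bar>\<integral>\<omega>. f (X \<omega>) - g (X \<omega>) \<partial>M\<bar>"
    using f g by simp
  also have "\<dots> \<le> (\<integral>\<omega>. \<bar>f (X \<omega>) - g (X \<omega>)\<bar> \<partial>M)" by (rule integral_abs_bound)
  also have "\<dots> \<le> (\<integral>\<omega>. e + c * (norm (X \<omega>))\<^sup>2 \<partial>M)"
    using f g sq by (intro integral_mono) (auto simp: fg)
  also have "\<dots> = e + c * (\<integral>\<omega>. (norm (X \<omega>))\<^sup>2 \<partial>M)" using sq by (simp add: prob_space)
  also have "\<dots> \<le> e + c * K" using sq c by (intro add_left_mono mult_left_mono) auto
  finally show ?thesis .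
qed

text \<open>The common bound \<open>K\<close> on second moments replaces tightness: it controls the
  quadratic approximation error uniformly in \<open>i\<close>. The estimate is direct for each test
  function, without extracting subsequences, so it works along any filter.\<close>

theorem converges_in_distribution_char:
  fixes X :: "'i \<Rightarrow> 'w \<Rightarrow> 'a::euclidean_space" and Y :: "'v \<Rightarrow> 'a"
  assumes X: "\<forall>\<^sub>F i in F. prob_space (W i) \<and> X i \<in> borel_measurable (W i) \<and>
      integrable (W i) (\<lambda>\<omega>. (norm (X i \<omega>))\<^sup>2) \<and> (\<integral>\<omega>. (norm (X i \<omega>))\<^sup>2 \<partial>W i) \<le> K"
    and V: "prob_space V" and Y: "Y \<in> borel_measurable V"
      "integrable V (\<lambda>\<omega>. (norm (Y \<omega>))\<^sup>2)" "(\<integral>\<omega>. (norm (Y \<omega>))\<^sup>2 \<partial>V) \<le> K"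
    and cos: "\<And>t. ((\<lambda>i. \<integral>\<omega>. cos (t \<bullet> X i \<omega>) \<partial>W i) \<longlongrightarrow> (\<integral>\<omega>. cos (t \<bullet> Y \<omega>) \<partial>V)) F"
    and sin: "\<And>t. ((\<lambda>i. \<integral>\<omega>. sin (t \<bullet> X i \<omega>) \<partial>W i) \<longlongrightarrow> (\<integral>\<omega>. sin (t \<bullet> Y \<omega>) \<partial>V)) F"
  shows "converges_in_distribution W X V Y F"
  unfolding converges_in_distribution_def
proof (intro allI impI tendstoI; elim conjE)
  fix f :: "'a \<Rightarrow> real" and e :: real
  assume f: "continuous_on UNIV f" "bounded (range f)" and e: "e > 0"
  from f(2) obtain B where B: "\<And>x. \<bar>f x\<bar> \<le> B" by (auto simp: bounded_iff)
  have B0: "B \<ge> 0" using B[of 0] by linarith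
  have K0: "K \<ge> 0" using Y(3) by (rule order_trans[rotated]) (rule Bochner_Integration.integral_nonneg, simp)
  have fm: "f \<in> borel_measurable borel" using f(1) by (rule borel_measurable_continuous_onI)
  \<comment> \<open>Chosen so that \<open>2 * B * K / L\<^sup>2 \<le> e / 8\<close>; the summand 1
    keeps \<open>L\<close> positive when \<open>B * K = 0\<close>. The error budget is e/4 for
    \<open>X i\<close>, e/4 for \<open>Y\<close> and e/4 for the expectations of
    \<open>g\<close>.\<close>
  define L where "L = sqrt (8 * (2 * B * K + 1) / e)"
  have L: "L > 0" using B0 K0 e by (simp add: L_def add_nonneg_pos)
  have L2: "L\<^sup>2 = 8 * (2 * B * K + 1) / e" using B0 K0 e by (simp add: L_def)
  have small: "2 * B / L\<^sup>2 * K \<le> e / 8"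
  proof -
    have "2 * B / L\<^sup>2 * K = (2 * B * K) / (2 * B * K + 1) * (e / 8)"
    proof -
      have "a / (8 * b / e) = a / b * (e / 8)" for a b :: real by simp
      then show ?thesis unfolding L2 times_divide_eq_left by blast
    qed
    also have "\<dots> \<le> 1 * (e / 8)"
      using e B0 K0 by (intro mult_right_mono) (auto simp: divide_le_eq add_nonneg_pos)
    finally show ?thesis by simp
  qed
  obtain g where g: "trig_polynomial g" "\<And>x. \<bar>f x - g x\<bar> \<le> e / 8 + 2 * B / L\<^sup>2 * (norm x)\<^sup>2"
    using trig_polynomial_approximation[OF f(1) B, of "e / 8" L] e L by auto
  have c: "2 * B / L\<^sup>2 \<ge> 0" using B0 by simp
  have XW: "\<forall>\<^sub>F i in F. prob_space (W i) \<and> X i \<in> borel_measurable (W i)"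
    using X by eventually_elim simp
  have "((\<lambda>i. \<integral>\<omega>. g (X i \<omega>) \<partial>W i) \<longlongrightarrow> (\<integral>\<omega>. g (Y \<omega>) \<partial>V)) F"
    by (rule tendsto_expectation_trig_polynomial[OF XW V Y(1) cos sin g(1)])
  then have "\<forall>\<^sub>F i in F. dist (\<integral>\<omega>. g (X i \<omega>) \<partial>W i) (\<integral>\<omega>. g (Y \<omega>) \<partial>V) < e / 4"
    using e by (intro tendstoD) auto
  then show "\<forall>\<^sub>F i in F. dist (\<integral>\<omega>. f (X i \<omega>) \<partial>W i) (\<integral>\<omega>. f (Y \<omega>) \<partial>V) < e"
    using X
  proof eventually_elim
    case (elim i)
    have "\<bar>(\<integral>\<omega>. f (X i \<omega>) \<partial>W i) - (\<integral>\<omega>. g (X i \<omega>) \<partial>W i)\<bar> \<le> e / 8 + 2 * B / L\<^sup>2 * K"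
      by (rule prob_space.expectation_approximation[OF _ fm B g]) (use elim c in auto)
    moreover have "\<bar>(\<integral>\<omega>. f (Y \<omega>) \<partial>V) - (\<integral>\<omega>. g (Y \<omega>) \<partial>V)\<bar> \<le> e / 8 + 2 * B / L\<^sup>2 * K"
      by (rule prob_space.expectation_approximation[OF V fm B g]) (use Y c in auto)
    ultimately show ?case using elim(1) small e unfolding dist_real_def by linarith
  qed
qed

lemma converges_in_distribution_continuous_map:
  fixes h :: "'a::topological_space \<Rightarrow> 'b::topological_space"
  assumes "converges_in_distribution W X V Y F" "continuous_on UNIV h"
  shows "converges_in_distribution W (\<lambda>i \<omega>. h (X i \<omega>)) V (\<lambda>\<omega>. h (Y \<omega>)) F"
  unfolding converges_in_distribution_def
proof (intro allI impI; elim conjE)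
  fix f :: "'b \<Rightarrow> real" assume f: "continuous_on UNIV f" "bounded (range f)"
  have "continuous_on UNIV (f \<circ> h)"
    by (intro continuous_on_compose assms continuous_on_subset[OF f(1)]) auto
  moreover have "bounded (range (f \<circ> h))" by (rule bounded_subset[OF f(2)]) auto
  ultimately show "((\<lambda>i. \<integral>\<omega>. f (h (X i \<omega>)) \<partial>W i) \<longlongrightarrow> (\<integral>\<omega>. f (h (Y \<omega>)) \<partial>V)) F"
    using assms(1) unfolding converges_in_distribution_def by (auto simp: o_def)
qed

section \<open>Normal random vectors\<close>

text \<open>Treats the Dirac and the density case at once: characteristic functions and moments of
  an affine image of the standard normal law need no further case distinction.\<close>

lemma normal_law_conv_std:
  assumes "v \<ge> 0"
  shows "normal_law m v = distr std_normal_distribution borel (\<lambda>x. m + sqrt v * x)"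
proof (cases "v = 0")
  case True
  interpret prob_space std_normal_distribution by (rule prob_space_normal_density) simp
  show ?thesis using True by (simp add: normal_law_def)
next
  case False
  with assms have v: "sqrt v > 0" by simp
  interpret prob_space std_normal_distribution by (rule prob_space_normal_density) simp
  have "distributed std_normal_distribution lborel (\<lambda>x. x) (normal_density 0 1)"
    by (simp add: distributed_def distr_id2)
  from normal_density_affine[OF this, of "sqrt v" m]
  have "distr std_normal_distribution lborel (\<lambda>x. m + sqrt v * x) = density lborel (normal_density m (sqrt v))"
    using v by (simp add: distributed_def)
  then show ?thesis using False by (simp add: normal_law_def cong: distr_cong)
qed

lemma real_distribution_normal_law:
  assumes "v \<ge> 0"
  shows "real_distribution (normal_law m v)"
proof -
  interpret prob_space std_normal_distribution by (rule prob_space_normal_density) simp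
  show ?thesis unfolding normal_law_conv_std[OF assms] by (rule real_distribution_distr) simp
qed

lemma char_normal_law:
  assumes "v \<ge> 0"
  shows "char (normal_law m v) t = iexp (t * m) * complex_of_real (exp (- v * t\<^sup>2 / 2))"
proof -
  have "char (normal_law m v) t = (CLINT x|std_normal_distribution. iexp (t * m) * iexp ((t * sqrt v) * x))"
    unfolding normal_law_conv_std[OF assms] char_def
    by (subst integral_distr) (auto simp: algebra_simps exp_add[symmetric])
  also have "\<dots> = iexp (t * m) * char std_normal_distribution (t * sqrt v)"
    by (simp add: char_def)
  also have "\<dots> = iexp (t * m) * complex_of_real (exp (- v * t\<^sup>2 / 2))"
    using assms by (simp add: char_std_normal_distribution power_mult_distrib mult.commute)
  finally show ?thesis .
qed

lemma normal_law_second_moment: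
  assumes "v \<ge> 0"
  shows "integrable (normal_law m v) (\<lambda>x. x\<^sup>2)" "(\<integral>x. x\<^sup>2 \<partial>normal_law m v) = m\<^sup>2 + v"
proof -
  interpret prob_space std_normal_distribution by (rule prob_space_normal_density) simp
  have i: "integrable std_normal_distribution (\<lambda>x. x)" "integrable std_normal_distribution (\<lambda>x. x\<^sup>2)"
    using integrable_std_normal_distribution_moment[of 1] integrable_std_normal_distribution_moment[of 2] by simp_all
  have eq: "(m + sqrt v * x)\<^sup>2 = m\<^sup>2 + 2 * m * sqrt v * x + v * x\<^sup>2" for x
    using assms by (simp add: power2_sum power_mult_distrib algebra_simps)
  have e: "(\<integral>x. x \<partial>std_normal_distribution) = 0" "(\<integral>x. x\<^sup>2 \<partial>std_normal_distribution) = 1"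
    using integral_std_normal_distribution_moment_odd[of 1] std_normal_distribution_even_moments(1)[of 1]
    by (simp_all add: fact_numeral)
  have "integrable std_normal_distribution (\<lambda>x. (m + sqrt v * x)\<^sup>2)"
    unfolding eq using i by (intro Bochner_Integration.integrable_add integrable_mult_right) auto
  then show "integrable (normal_law m v) (\<lambda>x. x\<^sup>2)"
    unfolding normal_law_conv_std[OF assms] by (subst integrable_distr_eq) auto
  have "(\<integral>x. x\<^sup>2 \<partial>normal_law m v) = (\<integral>x. m\<^sup>2 + 2 * m * sqrt v * x + v * x\<^sup>2 \<partial>std_normal_distribution)"
    unfolding normal_law_conv_std[OF assms] by (subst integral_distr) (auto simp: eq)
  also have "\<dots> = m\<^sup>2 + v"
    using i e prob_space by (subst Bochner_Integration.integral_add, (auto)[2])+ simp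
  finally show "(\<integral>x. x\<^sup>2 \<partial>normal_law m v) = m\<^sup>2 + v" .
qed

lemma normal_random_vector_cos_sin:
  assumes "normal_random_vector W X \<mu> S"
  shows "(\<integral>\<omega>. cos (t \<bullet> X \<omega>) \<partial>W) = cos (t \<bullet> \<mu>) * exp (- (t \<bullet> (S *v t)) / 2)"
    and "(\<integral>\<omega>. sin (t \<bullet> X \<omega>) \<partial>W) = sin (t \<bullet> \<mu>) * exp (- (t \<bullet> (S *v t)) / 2)"
proof -
  have [measurable]: "X \<in> borel_measurable W" and v: "0 \<le> t \<bullet> (S *v t)"
    and d: "distr W borel (\<lambda>\<omega>. t \<bullet> X \<omega>) = normal_law (t \<bullet> \<mu>) (t \<bullet> (S *v t))" and "prob_space W"
    using assms by (auto simp: normal_random_vector_def)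
  then interpret prob_space W by simp
  have int: "integrable W (\<lambda>\<omega>. iexp (t \<bullet> X \<omega>))"
    by (rule integrable_const_bound[of _ 1]) auto
  \<comment> \<open>The characteristic function of a vector at \<open>t\<close> is that of the law
    of \<open>t \<bullet> X\<close> at 1, and this law is normal by definition.\<close>
  have "(CLINT \<omega>|W. iexp (t \<bullet> X \<omega>)) = char (distr W borel (\<lambda>\<omega>. t \<bullet> X \<omega>)) 1"
    unfolding char_def by (subst integral_distr) auto
  also have "\<dots> = iexp (t \<bullet> \<mu>) * complex_of_real (exp (- (t \<bullet> (S *v t)) / 2))"
    unfolding d char_normal_law[OF v] by simp
  finally have *: "(CLINT \<omega>|W. iexp (t \<bullet> X \<omega>)) = iexp (t \<bullet> \<mu>) * complex_of_real (exp (- (t \<bullet> (S *v t)) / 2))" .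
  have iexp: "iexp y = Complex (cos y) (sin y)" for y
    using cis_conv_exp[of y] by (simp add: complex_eq_iff)
  show "(\<integral>\<omega>. cos (t \<bullet> X \<omega>) \<partial>W) = cos (t \<bullet> \<mu>) * exp (- (t \<bullet> (S *v t)) / 2)"
    using arg_cong[OF *, of Re] integral_Re[OF int] unfolding iexp by simp
  show "(\<integral>\<omega>. sin (t \<bullet> X \<omega>) \<partial>W) = sin (t \<bullet> \<mu>) * exp (- (t \<bullet> (S *v t)) / 2)"
    using arg_cong[OF *, of Im] integral_Im[OF int] unfolding iexp by simp
qed

lemma normal_random_vector_second_moment:
  fixes S :: "real ^ 'n ^ 'n"
  assumes "normal_random_vector W X \<mu> S"
  shows "integrable W (\<lambda>\<omega>. (norm (X \<omega>))\<^sup>2)"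
    and "(\<integral>\<omega>. (norm (X \<omega>))\<^sup>2 \<partial>W) = (\<Sum>b\<in>Basis. (b \<bullet> \<mu>)\<^sup>2 + b \<bullet> (S *v b))"
proof -
  have [measurable]: "X \<in> borel_measurable W" and v: "\<And>t. 0 \<le> t \<bullet> (S *v t)"
    and d: "\<And>t. distr W borel (\<lambda>\<omega>. t \<bullet> X \<omega>) = normal_law (t \<bullet> \<mu>) (t \<bullet> (S *v t))"
    using assms by (auto simp: normal_random_vector_def)
  have i: "integrable W (\<lambda>\<omega>. (t \<bullet> X \<omega>)\<^sup>2)" for t
    using normal_law_second_moment(1)[OF v[of t], of "t \<bullet> \<mu>"]
    unfolding d[symmetric] by (subst (asm) integrable_distr_eq) auto
  have e: "(\<integral>\<omega>. (t \<bullet> X \<omega>)\<^sup>2 \<partial>W) = (t \<bullet> \<mu>)\<^sup>2 + t \<bullet> (S *v t)" for t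
    using normal_law_second_moment(2)[OF v[of t], of "t \<bullet> \<mu>"]
    unfolding d[symmetric] by (subst (asm) integral_distr) auto
  have n: "(norm y)\<^sup>2 = (\<Sum>b\<in>Basis. (b \<bullet> y)\<^sup>2)" for y :: "real ^ 'n"
    by (subst power2_norm_eq_inner, subst euclidean_inner) (simp add: power2_eq_square inner_commute)
  show "integrable W (\<lambda>\<omega>. (norm (X \<omega>))\<^sup>2)" unfolding n by (intro Bochner_Integration.integrable_sum i)
  show "(\<integral>\<omega>. (norm (X \<omega>))\<^sup>2 \<partial>W) = (\<Sum>b\<in>Basis. (b \<bullet> \<mu>)\<^sup>2 + b \<bullet> (S *v b))"
    unfolding n by (subst Bochner_Integration.integral_sum) (auto simp: i e)
qed

section \<open>Limits and transformations of normal vectors\<close>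

theorem converges_in_distribution_normal:
  fixes S :: "'i \<Rightarrow> real ^ 'n ^ 'n"
  assumes X: "\<forall>\<^sub>F i in F. normal_random_vector (W i) (X i) (\<mu> i) (S i)"
    and Y: "normal_random_vector V Y \<mu>' S'"
    and \<mu>: "\<And>t. ((\<lambda>i. t \<bullet> \<mu> i) \<longlongrightarrow> t \<bullet> \<mu>') F"
    and S: "\<And>t. ((\<lambda>i. t \<bullet> (S i *v t)) \<longlongrightarrow> t \<bullet> (S' *v t)) F"
  shows "converges_in_distribution W X V Y F"
proof -
  \<comment> \<open>One more than the limiting second moment: the second moments converge, hence are
    eventually below \<open>K\<close>, and the limit vector obeys the same bound.\<close>
  define K where "K = (\<Sum>b\<in>Basis. (b \<bullet> \<mu>')\<^sup>2 + b \<bullet> (S' *v b)) + 1"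
  have "((\<lambda>i. \<Sum>b\<in>Basis. (b \<bullet> \<mu> i)\<^sup>2 + b \<bullet> (S i *v b)) \<longlongrightarrow> (\<Sum>b\<in>Basis. (b \<bullet> \<mu>')\<^sup>2 + b \<bullet> (S' *v b))) F"
    by (intro tendsto_intros \<mu> S)
  then have K: "\<forall>\<^sub>F i in F. (\<Sum>b\<in>Basis. (b \<bullet> \<mu> i)\<^sup>2 + b \<bullet> (S i *v b)) < K"
    by (rule order_tendstoD) (simp add: K_def)
  show ?thesis
  proof (rule converges_in_distribution_char[where K = K])
    show "\<forall>\<^sub>F i in F. prob_space (W i) \<and> X i \<in> borel_measurable (W i) \<and>
      integrable (W i) (\<lambda>\<omega>. (norm (X i \<omega>))\<^sup>2) \<and> (\<integral>\<omega>. (norm (X i \<omega>))\<^sup>2 \<partial>W i) \<le> K"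
      using X K
    proof eventually_elim
      case (elim i)
      then show ?case using normal_random_vector_second_moment[OF elim(1)]
        by (auto simp: normal_random_vector_def)
    qed
    show "((\<lambda>i. \<integral>\<omega>. cos (t \<bullet> X i \<omega>) \<partial>W i) \<longlongrightarrow> (\<integral>\<omega>. cos (t \<bullet> Y \<omega>) \<partial>V)) F" for t
    proof (rule Lim_transform_eventually)
      show "((\<lambda>i. cos (t \<bullet> \<mu> i) * exp (- (t \<bullet> (S i *v t)) / 2)) \<longlongrightarrow> (\<integral>\<omega>. cos (t \<bullet> Y \<omega>) \<partial>V)) F"
        unfolding normal_random_vector_cos_sin[OF Y]
        by (intro tendsto_mult isCont_tendsto_compose[OF isCont_cos \<mu>] tendsto_exp tendsto_divide tendsto_minus tendsto_const S) simp
      show "\<forall>\<^sub>F i in F. cos (t \<bullet> \<mu> i) * exp (- (t \<bullet> (S i *v t)) / 2) = (\<integral>\<omega>. cos (t \<bullet> X i \<omega>) \<partial>W i)"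
        using X by eventually_elim (simp add: normal_random_vector_cos_sin)
    qed
    show "((\<lambda>i. \<integral>\<omega>. sin (t \<bullet> X i \<omega>) \<partial>W i) \<longlongrightarrow> (\<integral>\<omega>. sin (t \<bullet> Y \<omega>) \<partial>V)) F" for t
    proof (rule Lim_transform_eventually)
      show "((\<lambda>i. sin (t \<bullet> \<mu> i) * exp (- (t \<bullet> (S i *v t)) / 2)) \<longlongrightarrow> (\<integral>\<omega>. sin (t \<bullet> Y \<omega>) \<partial>V)) F"
        unfolding normal_random_vector_cos_sin[OF Y]
        by (intro tendsto_mult isCont_tendsto_compose[OF isCont_sin \<mu>] tendsto_exp tendsto_divide tendsto_minus tendsto_const S) simp
      show "\<forall>\<^sub>F i in F. sin (t \<bullet> \<mu> i) * exp (- (t \<bullet> (S i *v t)) / 2) = (\<integral>\<omega>. sin (t \<bullet> X i \<omega>) \<partial>W i)"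
        using X by eventually_elim (simp add: normal_random_vector_cos_sin)
    qed
  qed (use Y normal_random_vector_second_moment[OF Y] in \<open>auto simp: normal_random_vector_def K_def\<close>)
qed

text \<open>Comparing characteristic functions also covers \<open>c = 0\<close> and zero variance,
  where there is no density to transform.\<close>

lemma normal_random_vector_affine:
  fixes S :: "real ^ 'n ^ 'n"
  assumes "normal_random_vector W X \<mu> S"
  shows "normal_random_vector W (\<lambda>\<omega>. b + c *\<^sub>R X \<omega>) (b + c *\<^sub>R \<mu>) (c\<^sup>2 *\<^sub>R S)"
proof -
  have [measurable]: "X \<in> borel_measurable W" and p: "prob_space W" and v: "\<And>t. 0 \<le> t \<bullet> (S *v t)"
    and d: "\<And>t. distr W borel (\<lambda>\<omega>. t \<bullet> X \<omega>) = normal_law (t \<bullet> \<mu>) (t \<bullet> (S *v t))"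
    and s: "transpose S = S"
    using assms by (auto simp: normal_random_vector_def)
  have q: "t \<bullet> ((c\<^sup>2 *\<^sub>R S) *v t) = c\<^sup>2 * (t \<bullet> (S *v t))" for t
    by (simp add: scaleR_matrix_vector_assoc[symmetric])
  have "distr W borel (\<lambda>\<omega>. t \<bullet> (b + c *\<^sub>R X \<omega>)) = normal_law (t \<bullet> (b + c *\<^sub>R \<mu>)) (t \<bullet> ((c\<^sup>2 *\<^sub>R S) *v t))" for t
  proof -
    have "distr W borel (\<lambda>\<omega>. t \<bullet> (b + c *\<^sub>R X \<omega>)) = distr (distr W borel (\<lambda>\<omega>. t \<bullet> X \<omega>)) borel (\<lambda>x. t \<bullet> b + c * x)"
      by (simp add: distr_distr o_def inner_add_right)
    also have "\<dots> = normal_law (t \<bullet> (b + c *\<^sub>R \<mu>)) (t \<bullet> ((c\<^sup>2 *\<^sub>R S) *v t))"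
    proof (rule Levy_uniqueness)
      interpret N: real_distribution "normal_law (t \<bullet> \<mu>) (t \<bullet> (S *v t))"
        by (rule real_distribution_normal_law[OF v])
      show "real_distribution (distr (distr W borel (\<lambda>\<omega>. t \<bullet> X \<omega>)) borel (\<lambda>x. t \<bullet> b + c * x))"
        unfolding d by (rule N.real_distribution_distr) simp
      show "real_distribution (normal_law (t \<bullet> (b + c *\<^sub>R \<mu>)) (t \<bullet> ((c\<^sup>2 *\<^sub>R S) *v t)))"
        unfolding q by (rule real_distribution_normal_law) (simp add: v)
      show "char (distr (distr W borel (\<lambda>\<omega>. t \<bullet> X \<omega>)) borel (\<lambda>x. t \<bullet> b + c * x)) =
        char (normal_law (t \<bullet> (b + c *\<^sub>R \<mu>)) (t \<bullet> ((c\<^sup>2 *\<^sub>R S) *v t)))"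
      proof
        fix r
        have "char (distr (distr W borel (\<lambda>\<omega>. t \<bullet> X \<omega>)) borel (\<lambda>x. t \<bullet> b + c * x)) r =
          (CLINT x|normal_law (t \<bullet> \<mu>) (t \<bullet> (S *v t)). iexp (r * (t \<bullet> b)) * iexp ((r * c) * x))"
          unfolding char_def d by (subst integral_distr) (auto simp: algebra_simps exp_add[symmetric])
        also have "\<dots> = iexp (r * (t \<bullet> b)) * char (normal_law (t \<bullet> \<mu>) (t \<bullet> (S *v t))) (r * c)"
          by (simp add: char_def)
        also have "\<dots> = char (normal_law (t \<bullet> (b + c *\<^sub>R \<mu>)) (t \<bullet> ((c\<^sup>2 *\<^sub>R S) *v t))) r"
          unfolding q using v[of t]
          by (simp add: char_normal_law algebra_simps exp_add inner_add_right power_mult_distrib)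
        finally show "char (distr (distr W borel (\<lambda>\<omega>. t \<bullet> X \<omega>)) borel (\<lambda>x. t \<bullet> b + c * x)) r =
          char (normal_law (t \<bullet> (b + c *\<^sub>R \<mu>)) (t \<bullet> ((c\<^sup>2 *\<^sub>R S) *v t))) r" .
      qed
    qed
    finally show ?thesis .
  qed
  moreover have "transpose (c\<^sup>2 *\<^sub>R S) = c\<^sup>2 *\<^sub>R S"
    using s by (simp add: transpose_def vec_eq_iff)
  ultimately show ?thesis using p by (simp add: normal_random_vector_def q v)
qed

lemma sum_outer_product_quadratic_form:
  fixes p q t :: "real ^ 'n"
  shows "t \<bullet> ((\<chi> i j. p $ i * p $ j + q $ i * q $ j) *v t) = (t \<bullet> p)\<^sup>2 + (t \<bullet> q)\<^sup>2"
proof -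
  have "t \<bullet> ((\<chi> i j. p $ i * p $ j + q $ i * q $ j) *v t) =
      (\<Sum>i\<in>UNIV. \<Sum>j\<in>UNIV. (t $ i * p $ i) * (t $ j * p $ j) + (t $ i * q $ i) * (t $ j * q $ j))"
    by (simp add: inner_vec_def matrix_vector_mult_def sum_distrib_left algebra_simps)
  also have "\<dots> = (t \<bullet> p)\<^sup>2 + (t \<bullet> q)\<^sup>2"
    by (simp add: inner_vec_def power2_eq_square sum_product sum.distrib)
  finally show ?thesis .
qed

text \<open>Characteristic functions of independent summands multiply, so the variances add to a sum
  of squares. As \<open>p\<close> and \<open>q\<close> may be parallel or zero, the covariance can
  have rank below two.\<close>

lemma normal_random_vector_two_normals:
  fixes p q :: "real ^ 'n"
  assumes V: "prob_space V"
    and G: "distributed V lborel G1 std_normal_density" "distributed V lborel G2 std_normal_density"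
      "prob_space.indep_var V borel G1 borel G2"
  shows "normal_random_vector V (\<lambda>\<omega>. G1 \<omega> *\<^sub>R p + G2 \<omega> *\<^sub>R q) 0 (\<chi> i j. p $ i * p $ j + q $ i * q $ j)"
    (is "normal_random_vector V ?u 0 ?S")
proof -
  interpret prob_space V by (rule V)
  have [measurable]: "G1 \<in> borel_measurable V" "G2 \<in> borel_measurable V"
    using G(1,2) by (simp_all add: distributed_def)
  note quad = sum_outer_product_quadratic_form[of _ p q]
  have char_G: "char (distr V borel (\<lambda>\<omega>. a * G \<omega>)) r = complex_of_real (exp (- (a * r)\<^sup>2 / 2))"
    if G: "distributed V lborel G std_normal_density" for a r and G :: "'a \<Rightarrow> real"
  proof -
    have [measurable]: "G \<in> borel_measurable V" using G by (simp add: distributed_def)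
    have std: "distr V borel G = std_normal_distribution"
      using G by (simp add: distributed_def cong: distr_cong)
    have "char (distr V borel (\<lambda>\<omega>. a * G \<omega>)) r = char (distr V borel G) (a * r)"
      unfolding char_def by (simp add: integral_distr ac_simps)
    then show ?thesis by (simp add: std char_std_normal_distribution)
  qed
  have "distr V borel (\<lambda>\<omega>. t \<bullet> ?u \<omega>) = normal_law (t \<bullet> 0) (t \<bullet> (?S *v t))" for t
  proof (rule Levy_uniqueness)
    show "real_distribution (distr V borel (\<lambda>\<omega>. t \<bullet> ?u \<omega>))"
      by (rule real_distribution_distr) simp
    show "real_distribution (normal_law (t \<bullet> 0) (t \<bullet> (?S *v t)))"
      unfolding quad by (rule real_distribution_normal_law) simp
    show "char (distr V borel (\<lambda>\<omega>. t \<bullet> ?u \<omega>)) = char (normal_law (t \<bullet> 0) (t \<bullet> (?S *v t)))"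
    proof
      fix r
      have "indep_var borel ((*) (t \<bullet> p) \<circ> G1) borel ((*) (t \<bullet> q) \<circ> G2)"
        by (rule indep_var_compose[OF G(3)]) auto
      then have ind: "indep_var borel (\<lambda>\<omega>. (t \<bullet> p) * G1 \<omega>) borel (\<lambda>\<omega>. (t \<bullet> q) * G2 \<omega>)"
        by (simp add: o_def)
      have "char (distr V borel (\<lambda>\<omega>. t \<bullet> ?u \<omega>)) r =
          char (distr V borel (\<lambda>\<omega>. (t \<bullet> p) * G1 \<omega> + (t \<bullet> q) * G2 \<omega>)) r"
        by (simp add: inner_add_right mult.commute)
      also have "\<dots> = complex_of_real (exp (- (t \<bullet> p * r)\<^sup>2 / 2) * exp (- (t \<bullet> q * r)\<^sup>2 / 2))"
        by (simp add: char_distr_add[OF ind] char_G G)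
      also have "\<dots> = char (normal_law (t \<bullet> 0) (t \<bullet> (?S *v t))) r"
        unfolding quad
        by (subst char_normal_law) (auto simp: exp_add[symmetric] power_mult_distrib field_simps)
      finally show "char (distr V borel (\<lambda>\<omega>. t \<bullet> ?u \<omega>)) r = char (normal_law (t \<bullet> 0) (t \<bullet> (?S *v t))) r" .
    qed
  qed
  moreover have "transpose ?S = ?S" by (simp add: transpose_def vec_eq_iff mult.commute)
  ultimately show ?thesis by (simp add: normal_random_vector_def quad V)
qed

section \<open>Diagonalizable matrices and the Lyapunov operator\<close>

definition diag_mat :: "('n \<Rightarrow> 'a) \<Rightarrow> 'a::zero ^ 'n ^ 'n" where
  "diag_mat d = (\<chi> i j. if i = j then d i else 0)"

lemma det_diag_mat: "det (diag_mat d :: 'a::comm_ring_1 ^ 'n ^ 'n) = (\<Prod>k\<in>UNIV. d k)"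
  by (subst det_diagonal) (auto simp: diag_mat_def)

lemma diag_conj_nth:
  fixes S S' :: "'a::comm_ring_1 ^ 'n ^ 'n"
  shows "(S ** diag_mat d ** S') $ i $ j = (\<Sum>k\<in>UNIV. S $ i $ k * d k * S' $ k $ j)"
  by (simp add: matrix_matrix_mult_def diag_mat_def if_distrib[where f="\<lambda>x. _ * x"] cong: if_cong)

lemma matrix_mult_mat1_nth:
  fixes S S' :: "'a::comm_ring_1 ^ 'n ^ 'n"
  assumes "S ** S' = mat 1"
  shows "(\<Sum>k\<in>UNIV. S $ i $ k * S' $ k $ j) = (if i = j then 1 else 0)"
  using arg_cong[OF assms, of "\<lambda>A. A $ i $ j"] by (simp add: matrix_matrix_mult_def mat_def)

text \<open>The Kronecker sum \<open>A \<otimes> I + I \<otimes> A\<close>: the Lyapunov operator in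
  coordinates indexed by pairs, so that determinants and Cramer's rule apply to it.\<close>

definition sylvester_matrix :: "'a::comm_ring_1 ^ 'n ^ 'n \<Rightarrow> 'a ^ ('n \<times> 'n) ^ ('n \<times> 'n)" where
  "sylvester_matrix A = (\<chi> p q.
     A $ fst p $ fst q * (if snd p = snd q then 1 else 0) +
     (if fst p = fst q then 1 else 0) * A $ snd p $ snd q)"

definition vectorize :: "'a ^ 'n ^ 'n \<Rightarrow> 'a ^ ('n \<times> 'n)" where
  "vectorize X = (\<chi> p. X $ fst p $ snd p)"

lemma sum_UNIV_prod:
  fixes f :: "'a::finite \<times> 'b::finite \<Rightarrow> 'c::comm_monoid_add"
  shows "(\<Sum>p\<in>UNIV. f p) = (\<Sum>i\<in>UNIV. \<Sum>j\<in>UNIV. f (i, j))"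
  by (simp add: sum.cartesian_product UNIV_Times_UNIV[symmetric] del: UNIV_Times_UNIV)

lemma sylvester_matrix_vectorize:
  "sylvester_matrix A *v vectorize X = vectorize (A ** X + X ** transpose A)"
proof -
  have "(sylvester_matrix A *v vectorize X) $ (i, j) = vectorize (A ** X + X ** transpose A) $ (i, j)" for i j
  proof -
    have "(sylvester_matrix A *v vectorize X) $ (i, j) =
      (\<Sum>k\<in>UNIV. \<Sum>l\<in>UNIV. (if j = l then A $ i $ k * X $ k $ l else 0) +
         (if i = k then A $ j $ l * X $ k $ l else 0))"
      by (auto simp: sylvester_matrix_def vectorize_def matrix_vector_mult_def sum_UNIV_prod
          distrib_right intro!: sum.cong)
    also have "\<dots> = (\<Sum>k\<in>UNIV. A $ i $ k * X $ k $ j) + (\<Sum>l\<in>UNIV. A $ j $ l * X $ i $ l)"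
    proof -
      have "(\<Sum>k\<in>UNIV. \<Sum>l\<in>UNIV. (if i = k then A $ j $ l * X $ k $ l else 0)) =
        (\<Sum>k\<in>UNIV. if i = k then (\<Sum>l\<in>UNIV. A $ j $ l * X $ k $ l) else 0)"
        by (intro sum.cong) auto
      then show ?thesis by (simp add: sum.distrib)
    qed
    finally show ?thesis
      by (simp add: vectorize_def matrix_matrix_mult_def transpose_def mult.commute)
  qed
  then show ?thesis by (simp add: vec_eq_iff)
qed

lemma det_sylvester_matrix:
  fixes S S' :: "'a::comm_ring_1 ^ 'n ^ 'n"
  assumes inv: "S ** S' = mat 1"
  shows "det (sylvester_matrix (S ** diag_mat d ** S')) = (\<Prod>p\<in>UNIV. d (fst p) + d (snd p))"
proof -
  \<comment> \<open>\<open>K T\<close> is the Kronecker square \<open>T \<otimes> T\<close>.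
    Conjugation by it diagonalizes the Kronecker sum, with entries \<open>e\<close>, and the
    determinants of \<open>K S\<close> and \<open>K S'\<close> cancel, so the size of
    \<open>S\<close> and \<open>S'\<close> never enters.\<close>
  define K where "K = (\<lambda>T :: 'a ^ 'n ^ 'n. (\<chi> p q. T $ fst p $ fst q * T $ snd p $ snd q) :: 'a ^ ('n \<times> 'n) ^ ('n \<times> 'n))"
  define e where "e = (\<lambda>p :: 'n \<times> 'n. d (fst p) + d (snd p))"
  have "(K S ** K S') $ (i, j) $ (k, l) = mat 1 $ (i, j) $ (k, l)" for i j k l
  proof -
    have "(K S ** K S') $ (i, j) $ (k, l) =
        (\<Sum>a\<in>UNIV. \<Sum>b\<in>UNIV. (S $ i $ a * S' $ a $ k) * (S $ j $ b * S' $ b $ l))"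
      by (simp add: matrix_matrix_mult_def K_def sum_UNIV_prod ac_simps)
    also have "\<dots> = (\<Sum>a\<in>UNIV. S $ i $ a * S' $ a $ k) * (\<Sum>b\<in>UNIV. S $ j $ b * S' $ b $ l)"
      by (simp add: sum_product)
    finally show ?thesis by (simp add: matrix_mult_mat1_nth[OF inv] mat_def)
  qed
  then have KK: "K S ** K S' = mat 1" by (simp add: vec_eq_iff)
  have "sylvester_matrix (S ** diag_mat d ** S') $ (i, j) $ (k, l) =
     (K S ** diag_mat e ** K S') $ (i, j) $ (k, l)" for i j k l
  proof -
    have "(K S ** diag_mat e ** K S') $ (i, j) $ (k, l) =
      (\<Sum>a\<in>UNIV. \<Sum>b\<in>UNIV. (S $ i $ a * d a * S' $ a $ k) * (S $ j $ b * S' $ b $ l) +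
         (S $ i $ a * S' $ a $ k) * (S $ j $ b * d b * S' $ b $ l))"
      by (simp add: diag_conj_nth K_def e_def sum_UNIV_prod algebra_simps)
    also have "\<dots> = (\<Sum>a\<in>UNIV. S $ i $ a * d a * S' $ a $ k) * (\<Sum>b\<in>UNIV. S $ j $ b * S' $ b $ l) +
         (\<Sum>a\<in>UNIV. S $ i $ a * S' $ a $ k) * (\<Sum>b\<in>UNIV. S $ j $ b * d b * S' $ b $ l)"
      by (simp add: sum_product sum.distrib)
    finally show ?thesis
      by (simp add: matrix_mult_mat1_nth[OF inv] diag_conj_nth sylvester_matrix_def)
  qed
  then have eq: "sylvester_matrix (S ** diag_mat d ** S') = K S ** diag_mat e ** K S'"
    by (simp add: vec_eq_iff)
  have "det (K S) * det (K S') = 1" using arg_cong[OF KK, of det] by (simp add: det_mul)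
  then show ?thesis unfolding eq det_mul det_diag_mat e_def
    by (metis (no_types, lifting) mult.commute mult.left_commute mult.right_neutral)
qed

lemma tendsto_det:
  fixes A :: "'i \<Rightarrow> 'a::real_normed_field ^ 'n ^ 'n"
  assumes "\<And>i j. ((\<lambda>x. A x $ i $ j) \<longlongrightarrow> A' $ i $ j) F"
  shows "((\<lambda>x. det (A x)) \<longlongrightarrow> det A') F"
  unfolding det_def by (intro tendsto_intros assms)

text \<open>The determinant of the Sylvester matrix is the product of the sums \<open>d i + d j\<close>, hence bounded away
  from zero however badly conditioned the diagonalizing matrices are; by Cramer's rule the solutions
  then depend continuously on the data up to the limit.\<close>

lemma lyapunov_solution_convergent:
  fixes A R X :: "'i \<Rightarrow> complex ^ 'n ^ 'n"
  assumes A: "\<And>i j. ((\<lambda>x. A x $ i $ j) \<longlongrightarrow> Ac $ i $ j) F"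
    and R: "\<And>i j. ((\<lambda>x. R x $ i $ j) \<longlongrightarrow> Rc $ i $ j) F"
    and \<delta>: "\<delta> > 0"
    and diag: "\<forall>\<^sub>F x in F. \<exists>(S :: complex ^ 'n ^ 'n) S' d. S ** S' = mat 1 \<and> A x = S ** diag_mat d ** S' \<and> (\<forall>k. Re (d k) \<ge> \<delta>)"
    and eq: "\<forall>\<^sub>F x in F. A x ** X x + X x ** transpose (A x) = R x"
  shows "\<exists>Xc. \<forall>i j. ((\<lambda>x. X x $ i $ j) \<longlongrightarrow> Xc $ i $ j) F"
proof (cases "F = bot")
  case False
  let ?L = "\<lambda>x. sylvester_matrix (A x)" and ?m = "card (UNIV :: ('n \<times> 'n) set)"
  have L: "((\<lambda>x. ?L x $ p $ q) \<longlongrightarrow> sylvester_matrix Ac $ p $ q) F" for p q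
    by (auto simp: sylvester_matrix_def intro!: tendsto_intros A)
  have dL: "((\<lambda>x. det (?L x)) \<longlongrightarrow> det (sylvester_matrix Ac)) F"
    by (rule tendsto_det) (rule L)
  have bound: "\<forall>\<^sub>F x in F. norm (det (?L x)) \<ge> (2 * \<delta>) ^ ?m"
    using diag
  proof eventually_elim
    case (elim x)
    then obtain S S' :: "complex ^ 'n ^ 'n" and d where *: "S ** S' = mat 1" "A x = S ** diag_mat d ** S'" "\<And>k. Re (d k) \<ge> \<delta>"
      by metis
    have "(2 * \<delta>) ^ ?m = (\<Prod>p\<in>(UNIV :: ('n \<times> 'n) set). 2 * \<delta>)" by simp
    also have "\<dots> \<le> (\<Prod>p\<in>(UNIV :: ('n \<times> 'n) set). norm (d (fst p) + d (snd p)))"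
    proof (intro prod_mono conjI)
      fix p :: "'n \<times> 'n"
      have "2 * \<delta> \<le> Re (d (fst p) + d (snd p))" using *(3)[of "fst p"] *(3)[of "snd p"] by simp
      also have "\<dots> \<le> norm (d (fst p) + d (snd p))" by (rule complex_Re_le_cmod)
      finally show "2 * \<delta> \<le> norm (d (fst p) + d (snd p))" .
    qed (use \<delta> in auto)
    finally show ?case by (simp add: *(2) det_sylvester_matrix[OF *(1)] prod_norm)
  qed
  \<comment> \<open>The bound passes to the limit because \<open>F\<close> is not trivial. It makes
    the limiting operator invertible, although \<open>Ac\<close> itself is not known to be
    diagonalizable.\<close>
  have "norm (det (sylvester_matrix Ac)) \<ge> (2 * \<delta>) ^ ?m"
    using tendsto_lowerbound[OF tendsto_norm[OF dL] bound False] .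
  moreover have "(2 * \<delta>) ^ ?m > 0" using \<delta> by simp
  ultimately have nz: "det (sylvester_matrix Ac) \<noteq> 0" by (metis norm_zero not_le)
  \<comment> \<open>The numerators of Cramer's rule: one column of the Sylvester matrix is replaced
    by the right-hand side. Being polynomials in the entries of \<open>B\<close> and
    \<open>T\<close>, they converge with the data.\<close>
  define num where "num = (\<lambda>B :: complex ^ 'n ^ 'n. \<lambda>T :: complex ^ 'n ^ 'n. \<lambda>k.
     det (\<chi> p q. if q = k then vectorize T $ p else sylvester_matrix B $ p $ q) :: complex)"
  have X: "\<forall>\<^sub>F x in F. \<forall>k. num (A x) (R x) k / det (?L x) = vectorize (X x) $ k"
    using eq bound
  proof eventually_elim
    case (elim x)
    have "det (?L x) \<noteq> 0" using elim(2) \<open>(2 * \<delta>) ^ ?m > 0\<close> by (metis norm_zero not_le)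
    moreover have "?L x *v vectorize (X x) = vectorize (R x)"
      using elim(1) by (simp add: sylvester_matrix_vectorize)
    ultimately show ?case by (auto simp: cramer num_def)
  qed
  have "((\<lambda>x. num (A x) (R x) k) \<longlongrightarrow> num Ac Rc k) F" for k
    unfolding num_def by (rule tendsto_det) (auto simp: vectorize_def intro: L R)
  then have lim: "((\<lambda>x. num (A x) (R x) k / det (?L x)) \<longlongrightarrow> num Ac Rc k / det (sylvester_matrix Ac)) F" for k
    using dL nz by (intro tendsto_divide)
  have "((\<lambda>x. X x $ i $ j) \<longlongrightarrow> num Ac Rc (i, j) / det (sylvester_matrix Ac)) F" for i j
    by (rule Lim_transform_eventually[OF lim[of "(i, j)"]])
       (use X in \<open>eventually_elim, simp add: vectorize_def\<close>)
  then show ?thesis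
    by (intro exI[of _ "\<chi> i j. num Ac Rc (i, j) / det (sylvester_matrix Ac)"]) simp
qed simp

section \<open>Spectral data of a diagonalizable matrix\<close>

lemma matrix_inv_invertible:
  fixes S :: "'a::field ^ 'n ^ 'n"
  assumes "invertible S"
  shows "S ** matrix_inv S = mat 1" "matrix_inv S ** S = mat 1"
  using someI_ex[OF assms[unfolded invertible_def]] by (auto simp: matrix_inv_def)

lemma diagonalizableD:
  fixes A :: "'a::field ^ 'n ^ 'n"
  assumes "diagonalizable A"
  obtains S S' :: "'a ^ 'n ^ 'n" and d where "S ** S' = mat 1" "S' ** S = mat 1" "A = S ** diag_mat d ** S'"
proof -
  from assms obtain S D :: "'a ^ 'n ^ 'n" where *: "invertible S" "\<forall>i j. i \<noteq> j \<longrightarrow> D $ i $ j = 0"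
     "A = S ** D ** matrix_inv S" by (auto simp: diagonalizable_def)
  have D: "D = diag_mat (\<lambda>k. D $ k $ k)" using *(2) by (auto simp: diag_mat_def vec_eq_iff)
  show ?thesis
    by (rule that[OF matrix_inv_invertible[OF *(1)], of "\<lambda>k. D $ k $ k"]) (use *(3) D in simp)
qed

text \<open>Viewed as constant polynomials, the entries of \<open>S\<close> and \<open>S'\<close>
  still form inverse matrices, so \<open>X I - A\<close> is conjugate to a diagonal matrix over the
  polynomial ring.\<close>

lemma charpoly_diag_conj:
  fixes S S' :: "'a::field ^ 'n ^ 'n"
  assumes inv: "S ** S' = mat 1"
  shows "charpoly (S ** diag_mat d ** S') = (\<Prod>k\<in>UNIV. [:- d k, 1:])"
proof -
  define c :: "'a ^ 'n ^ 'n \<Rightarrow> 'a poly ^ 'n ^ 'n" where "c = map_matrix (\<lambda>a. [:a:])"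
  have sum_const: "(\<Sum>k\<in>UNIV. [:f k:]) = [:\<Sum>k\<in>UNIV. f k:]" for f :: "'n \<Rightarrow> 'a"
    by (induction rule: infinite_finite_induct[where A = UNIV]) auto
  have "(\<Sum>k\<in>UNIV. c S $ i $ k * [:- d k, 1:] * c S' $ k $ j) =
      (mat [:0, 1:] - c (S ** diag_mat d ** S')) $ i $ j" for i j
  proof -
    have "(\<Sum>k\<in>UNIV. c S $ i $ k * [:- d k, 1:] * c S' $ k $ j) =
       (\<Sum>k\<in>UNIV. [:0, 1:] * [:S $ i $ k * S' $ k $ j:] - [:S $ i $ k * d k * S' $ k $ j:])"
      by (intro sum.cong) (auto simp: c_def algebra_simps)
    also have "\<dots> = [:0, 1:] * [:\<Sum>k\<in>UNIV. S $ i $ k * S' $ k $ j:] - [:\<Sum>k\<in>UNIV. S $ i $ k * d k * S' $ k $ j:]"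
      by (simp only: sum_subtractf sum_distrib_left[symmetric] sum_const)
    finally show ?thesis
      by (auto simp: matrix_mult_mat1_nth[OF inv] diag_conj_nth c_def mat_def)
  qed
  then have eq: "mat [:0, 1:] - c (S ** diag_mat d ** S') = c S ** diag_mat (\<lambda>k. [:- d k, 1:]) ** c S'"
    by (simp add: vec_eq_iff diag_conj_nth)
  have "(c S ** c S') $ i $ j = mat 1 $ i $ j" for i j
  proof -
    have "(c S ** c S') $ i $ j = (\<Sum>k\<in>UNIV. [:S $ i $ k * S' $ k $ j:])"
      by (simp add: c_def matrix_matrix_mult_def mult.commute)
    then show ?thesis by (simp add: sum_const matrix_mult_mat1_nth[OF inv] mat_def one_pCons)
  qed
  then have "c S ** c S' = mat 1" by (simp add: vec_eq_iff)
  then have "det (c S) * det (c S') = 1" by (metis det_I det_mul)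
  then show ?thesis
    unfolding charpoly_def c_def[symmetric] eq det_mul det_diag_mat
    by (metis (no_types, lifting) mult.commute mult.left_commute mult.right_neutral)
qed

text \<open>The characteristic polynomial factors over the diagonal, so the algebraic multiplicity
  of \<mu> counts the indices that carry it.\<close>

lemma simple_eigenvalue_diag_conj:
  fixes S S' :: "'a::field ^ 'n ^ 'n"
  assumes inv: "S ** S' = mat 1" and simple: "simple_eigenvalue (S ** diag_mat d ** S') \<mu>"
  shows "\<exists>!k. d k = \<mu>"
proof -
  let ?p = "\<Prod>k\<in>UNIV. [:- d k, 1:]"
  have o: "order \<mu> ?p = 1"
    using simple by (simp add: simple_eigenvalue_def charpoly_diag_conj[OF inv])
  have nz: "?p \<noteq> 0" by simp
  have "poly ?p \<mu> = 0" using o by (simp add: order_root)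
  then obtain k where k: "d k = \<mu>" by (auto simp: poly_prod)
  have "l = k" if "d l = \<mu>" for l
  proof (rule ccontr)
    assume "l \<noteq> k"
    then have "?p = [:-\<mu>, 1:] * ([:-\<mu>, 1:] * (\<Prod>k\<in>UNIV - {k} - {l}. [:- d k, 1:]))"
      using k that by (simp add: prod.remove[of UNIV k] prod.remove[of "UNIV - {k}" l])
    then have "[:-\<mu>, 1:] ^ 2 dvd ?p" by (simp add: power2_eq_square mult.assoc[symmetric] del: mult_pCons_left mult_pCons_right)
    then show False using o nz by (simp add: order_divides)
  qed
  with k show ?thesis by auto
qed

text \<open>In the coordinates of \<open>S\<close> both eigenvectors are supported on the single
  index \<open>k\<close>, so they are multiples of a column of \<open>S\<close> and a row of
  \<open>S'\<close>. The normalization makes these multiples reciprocal: \<open>v w\<^sup>T\<close>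
  is the spectral projection for \<mu>, whatever the scaling of \<open>S\<close>.\<close>

lemma spectral_projection_diag_conj:
  fixes S S' :: "'a::field ^ 'n ^ 'n"
  assumes inv: "S ** S' = mat 1" "S' ** S = mat 1" and A: "A = S ** diag_mat d ** S'"
    and v: "A *v v = \<mu> *s v" and w: "w v* A = \<mu> *s w" and wv: "scalar_product w v = 1"
    and k: "\<And>l. d l = \<mu> \<longleftrightarrow> l = k"
  shows "v $ i * w $ j = S $ i $ k * S' $ k $ j"
proof -
  define v' w' where "v' = S' *v v" and "w' = w v* S"
  have Sv: "S *v v' = v" by (simp add: v'_def matrix_vector_mul_assoc inv)
  have Sw: "w' v* S' = w" by (simp add: w'_def vector_matrix_mul_assoc inv)
  have SA: "S' ** A = diag_mat d ** S'" "A ** S = S ** diag_mat d"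
    unfolding A by (metis inv matrix_mul_assoc matrix_mul_lid, metis inv matrix_mul_assoc matrix_mul_rid)
  have "diag_mat d *v v' = \<mu> *s v'"
    by (metis SA(1) v v'_def matrix_vector_mul_assoc matrix_vector_mult_scaleR vector_scalar_commute)
  then have "d l * v' $ l = \<mu> * v' $ l" for l
    by (auto simp: vec_eq_iff matrix_vector_mult_def diag_mat_def if_distrib[where f="\<lambda>x. x * _"] cong: if_cong)
  then have v'0: "v' $ l = 0" if "l \<noteq> k" for l using that k by (metis mult_right_cancel)
  have "w' v* diag_mat d = \<mu> *s w'"
    unfolding w'_def by (metis SA(2) w vector_matrix_mul_assoc scalar_vector_matrix_assoc)
  then have "w' $ l * d l = \<mu> * w' $ l" for l
    by (auto simp: vec_eq_iff vector_matrix_mult_def diag_mat_def if_distrib[where f="\<lambda>x. x * _"] if_distrib[where f="\<lambda>x. _ * x"] mult.commute cong: if_cong)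
  then have w'0: "w' $ l = 0" if "l \<noteq> k" for l using that k by (metis mult.commute mult_right_cancel)
  have vi: "v $ i = S $ i $ k * v' $ k" for i
  proof -
    have "v $ i = (\<Sum>l\<in>UNIV. S $ i $ l * v' $ l)" by (subst Sv[symmetric]) (simp add: matrix_vector_mult_def)
    also have "\<dots> = (\<Sum>l\<in>{k}. S $ i $ l * v' $ l)" by (rule sum.mono_neutral_right) (auto simp: v'0)
    finally show ?thesis by simp
  qed
  have wj: "w $ j = w' $ k * S' $ k $ j" for j
  proof -
    have "w $ j = (\<Sum>l\<in>UNIV. w' $ l * S' $ l $ j)" by (subst Sw[symmetric]) (simp add: vector_matrix_mult_def mult.commute)
    also have "\<dots> = (\<Sum>l\<in>{k}. w' $ l * S' $ l $ j)" by (rule sum.mono_neutral_right) (auto simp: w'0)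
    finally show ?thesis by simp
  qed
  have "1 = (\<Sum>i\<in>UNIV. w $ i * v $ i)" using wv by (simp add: scalar_product_def)
  also have "\<dots> = (\<Sum>i\<in>UNIV. (w' $ k * v' $ k) * (S' $ k $ i * S $ i $ k))"
    by (intro sum.cong) (auto simp: vi wj)
  also have "\<dots> = w' $ k * v' $ k"
    by (simp add: sum_distrib_left[symmetric] matrix_mult_mat1_nth[OF inv(2)])
  finally have *: "w' $ k * v' $ k = 1" by simp
  have "v $ i * w $ j = S $ i $ k * S' $ k $ j * (w' $ k * v' $ k)" by (simp add: vi wj ac_simps)
  then show ?thesis by (simp add: *)
qed

section \<open>The covariance near a Hopf pair\<close>

lemma diag_conj_mult:
  fixes S S' :: "'a::comm_ring_1 ^ 'n ^ 'n"
  assumes "S' ** S = mat 1"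
  shows "(S ** diag_mat a ** S') ** (S ** diag_mat b ** S') = S ** diag_mat (\<lambda>k. a k * b k) ** S'"
proof -
  have "(S ** diag_mat a ** S') ** (S ** diag_mat b ** S') = S ** (diag_mat a ** ((S' ** S) ** diag_mat b)) ** S'"
    by (simp add: matrix_mul_assoc)
  moreover have "diag_mat a ** diag_mat b = diag_mat (\<lambda>k. a k * b k)"
    by (simp add: matrix_matrix_mult_def diag_mat_def vec_eq_iff if_distrib[where f="\<lambda>x. _ * x"] cong: if_cong)
  ultimately show ?thesis by (simp add: assms matrix_mul_assoc)
qed

lemma eigenvalue_diag_conj:
  fixes S S' :: "'a::field ^ 'n ^ 'n"
  assumes inv: "S' ** S = mat 1"
  shows "eigenvalue (S ** diag_mat d ** S') (d k)"
proof -
  let ?A = "S ** diag_mat d ** S'" and ?e = "axis k 1 :: 'a ^ 'n"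
  have "S' *v (S *v ?e) = ?e" by (simp add: matrix_vector_mul_assoc inv)
  then have "S *v ?e \<noteq> 0" by (metis axis_eq_0_iff matrix_vector_mult_0_right zero_neq_one)
  have "diag_mat d *v ?e = d k *s ?e"
    by (auto simp: vec_eq_iff matrix_vector_mult_def diag_mat_def axis_def if_distrib[where f="\<lambda>x. _ * x"] if_distrib[where f="\<lambda>x. x * _"] cong: if_cong)
  moreover have "?A *v (S *v ?e) = S *v (diag_mat d *v (S' *v (S *v ?e)))"
    by (simp only: matrix_vector_mul_assoc matrix_mul_assoc)
  ultimately have "?A *v (S *v ?e) = d k *s (S *v ?e)"
    by (simp add: \<open>S' *v (S *v ?e) = ?e\<close> vector_scalar_commute)
  with \<open>S *v ?e \<noteq> 0\<close> show ?thesis by (auto simp: eigenvalue_def right_eigenvector_def)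
qed

section \<open>Complexification and the real projection of the critical pair\<close>

lemma complex_matrix_nth [simp]: "complex_matrix A $ i $ j = complex_of_real (A $ i $ j)"
  by (simp add: complex_matrix_def)

lemma complex_matrix_eq_iff: "complex_matrix A = complex_matrix B \<longleftrightarrow> A = B"
  by (simp add: vec_eq_iff)

lemma complex_matrix_simps:
  "complex_matrix (A + B) = complex_matrix A + complex_matrix B"
  "complex_matrix (A - B) = complex_matrix A - complex_matrix B"
  "complex_matrix (A ** D) = complex_matrix A ** complex_matrix D"
  "complex_matrix (transpose A) = transpose (complex_matrix A)"
  "complex_matrix (mat a) = mat (complex_of_real a)"
  by (simp_all add: vec_eq_iff matrix_matrix_mult_def transpose_def mat_def)

text \<open>\<open>v w\<^sup>T\<close> plus its complex conjugate. For normalized right and left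
  eigenvectors of a simple pair this is the spectral projection onto the plane of the pair.\<close>

definition hopf_projection :: "complex ^ 'n \<Rightarrow> complex ^ 'n \<Rightarrow> real ^ 'n ^ 'n" where
  "hopf_projection v w = (\<chi> i j. 2 * Re (v $ i * w $ j))"

text \<open>Extracts from a test vector its part in the span of \<open>Re_vec w\<close> and
  \<open>Im_vec w\<close>, where the form of the covariance is known explicitly. The minus sign is
  that of the real part of a complex product.\<close>

lemma transpose_hopf_projection_mult:
  "transpose (hopf_projection v w) *v t = (2 * (t \<bullet> Re_vec v)) *\<^sub>R Re_vec w - (2 * (t \<bullet> Im_vec v)) *\<^sub>R Im_vec w"
  by (simp add: hopf_projection_def vec_eq_iff transpose_def matrix_vector_mult_def Re_vec_def Im_vec_def
      inner_vec_def sum_distrib_left sum_distrib_right sum_subtractf[symmetric] algebra_simps)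

text \<open>Adding a multiple of the spectral projection moves the critical pair to the right of the gap
  and leaves the remaining spectral data unchanged.\<close>

lemma hopf_deflation:
  fixes M :: "real ^ 'n ^ 'n" and v w :: "complex ^ 'n"
  defines "P \<equiv> hopf_projection v w"
  assumes diag: "diagonalizable (complex_matrix M)"
    and simple: "simple_eigenvalue (complex_matrix M) (Complex \<eta> \<Omega>)"
      "simple_eigenvalue (complex_matrix M) (Complex \<eta> (- \<Omega>))"
    and pos: "\<eta> > 0" "\<Omega> \<noteq> 0"
    and gap: "\<And>k. eigenvalue (complex_matrix M) k \<Longrightarrow> k \<noteq> Complex \<eta> \<Omega> \<Longrightarrow> k \<noteq> Complex \<eta> (- \<Omega>) \<Longrightarrow> Re k \<ge> \<delta>"
    and right: "right_eigenvector (complex_matrix M) v (Complex \<eta> \<Omega>)"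
      "right_eigenvector (complex_matrix M) (cnj_vec v) (Complex \<eta> (- \<Omega>))"
    and left: "left_eigenvector (complex_matrix M) w (Complex \<eta> \<Omega>)"
      "left_eigenvector (complex_matrix M) (cnj_vec w) (Complex \<eta> (- \<Omega>))"
    and wv: "scalar_product w v = 1"
  obtains S S' :: "complex ^ 'n ^ 'n" and d where "S ** S' = mat 1"
    "complex_matrix (M + \<delta> *\<^sub>R P) = S ** diag_mat d ** S'" "\<And>k. Re (d k) \<ge> \<delta>"
    "(M + \<delta> *\<^sub>R P) ** (mat 1 - P) = (mat 1 - P) ** M"
proof -
  obtain S S' :: "complex ^ 'n ^ 'n" and d where inv: "S ** S' = mat 1" "S' ** S = mat 1"
    and A: "complex_matrix M = S ** diag_mat d ** S'"
    using diagonalizableD[OF diag] by metis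
  obtain k1 where k1: "\<And>l. d l = Complex \<eta> \<Omega> \<longleftrightarrow> l = k1"
    using simple_eigenvalue_diag_conj[OF inv(1) simple(1)[unfolded A]] by blast
  obtain k2 where k2: "\<And>l. d l = Complex \<eta> (- \<Omega>) \<longleftrightarrow> l = k2"
    using simple_eigenvalue_diag_conj[OF inv(1) simple(2)[unfolded A]] by blast
  have k12: "k1 \<noteq> k2" using k1[of k1] k2[of k1] pos by auto
  have "scalar_product (cnj_vec w) (cnj_vec v) = cnj (scalar_product w v)"
    by (simp add: scalar_product_def cnj_vec_def)
  then have wv': "scalar_product (cnj_vec w) (cnj_vec v) = 1" using wv by simp
  have p1: "v $ i * w $ j = S $ i $ k1 * S' $ k1 $ j" for i j
    using right(1) left(1) wv k1
    by (intro spectral_projection_diag_conj[OF inv A]) (auto simp: right_eigenvector_def left_eigenvector_def)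
  have p2: "cnj_vec v $ i * cnj_vec w $ j = S $ i $ k2 * S' $ k2 $ j" for i j
    using right(2) left(2) wv' k2
    by (intro spectral_projection_diag_conj[OF inv A]) (auto simp: right_eigenvector_def left_eigenvector_def)
  \<comment> \<open>Indicator of the two critical indices. Conjugated by \<open>S\<close> it becomes
    \<open>P\<close>, because each half of \<open>P\<close> is the rank-one piece of one
    index.\<close>
  define e :: "'n \<Rightarrow> complex" where "e = (\<lambda>k. if k = k1 \<or> k = k2 then 1 else 0)"
  have se: "(\<Sum>k\<in>UNIV. f k * e k * g k) = f k1 * g k1 + f k2 * g k2" for f g :: "'n \<Rightarrow> complex"
  proof -
    have "(\<Sum>k\<in>UNIV. f k * e k * g k) = (\<Sum>k\<in>{k1, k2}. f k * e k * g k)"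
      by (rule sum.mono_neutral_right) (auto simp: e_def)
    then show ?thesis using k12 by (simp add: e_def)
  qed
  have PE: "complex_matrix P = S ** diag_mat e ** S'"
  proof -
    have "complex_matrix P $ i $ j = v $ i * w $ j + cnj_vec v $ i * cnj_vec w $ j" for i j
      using complex_add_cnj[of "v $ i * w $ j"] by (simp add: P_def hopf_projection_def cnj_vec_def)
    then show ?thesis by (simp add: vec_eq_iff diag_conj_nth se p1 p2)
  qed
  \<comment> \<open>Only the two critical entries move, and their real part becomes
    \<open>\<eta> + \<delta>\<close>; the gap covers the others.\<close>
  define d' where "d' = (\<lambda>k. d k + complex_of_real \<delta> * e k)"
  have N: "complex_matrix (M + \<delta> *\<^sub>R P) = S ** diag_mat d' ** S'"
  proof -
    have "complex_matrix (M + \<delta> *\<^sub>R P) $ i $ j = complex_matrix M $ i $ j + complex_of_real \<delta> * complex_matrix P $ i $ j" for i j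
      by simp
    then show ?thesis
      unfolding A PE by (simp add: vec_eq_iff diag_conj_nth d'_def sum_distrib_left sum.distrib algebra_simps)
  qed
  have Q: "complex_matrix (mat 1 - P) = S ** diag_mat (\<lambda>k. 1 - e k) ** S'"
    unfolding complex_matrix_simps PE
    by (simp add: vec_eq_iff diag_conj_nth right_diff_distrib left_diff_distrib sum_subtractf
        matrix_mult_mat1_nth[OF inv(1)] mat_def)
  show thesis
  proof
    show "Re (d' k) \<ge> \<delta>" for k
    proof (cases "k = k1 \<or> k = k2")
      case True
      then show ?thesis using k1[of k1] k2[of k2] pos by (auto simp: d'_def e_def)
    next
      case False
      then show ?thesis
        using gap[of "d k"] k1[of k] k2[of k] eigenvalue_diag_conj[OF inv(2), of d k] A
        by (simp add: d'_def e_def)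
    qed
    have "complex_matrix ((M + \<delta> *\<^sub>R P) ** (mat 1 - P)) = S ** diag_mat (\<lambda>k. d' k * (1 - e k)) ** S'"
      by (simp only: complex_matrix_simps(3) N Q diag_conj_mult[OF inv(2)])
    \<comment> \<open>\<open>1 - e\<close> vanishes at the critical indices, the only ones where
      \<open>d'\<close> and \<open>d\<close> can differ; this is the intertwining relation.\<close>
    also have "(\<lambda>k. d' k * (1 - e k)) = (\<lambda>k. (1 - e k) * d k)" by (auto simp: d'_def e_def)
    also have "S ** diag_mat (\<lambda>k. (1 - e k) * d k) ** S' = complex_matrix ((mat 1 - P) ** M)"
      by (simp only: complex_matrix_simps(3) A Q diag_conj_mult[OF inv(2)])
    finally show "(M + \<delta> *\<^sub>R P) ** (mat 1 - P) = (mat 1 - P) ** M"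
      by (simp only: complex_matrix_eq_iff)
  qed (fact inv N)+
qed

section \<open>The Lyapunov equation under projections and on left eigenvectors\<close>

lemma matrix_add_rdistrib:
  fixes A B :: "'a::semiring_1 ^ 'n ^ 'm"
  shows "(A + B) ** D = A ** D + B ** D"
  by (simp add: vec_eq_iff matrix_matrix_mult_def distrib_right sum.distrib)

text \<open>An intertwiner carries solutions for \<open>M\<close> to solutions for \<open>N\<close>.
  With \<open>Q\<close> the complementary projection, the projected covariance thus solves an
  equation for the deflated matrix.\<close>

lemma lyapunov_conj:
  fixes M N Q C R :: "'a::comm_ring_1 ^ 'n ^ 'n"
  assumes "N ** Q = Q ** M" "M ** C + C ** transpose M = R"
  shows "N ** (Q ** C ** transpose Q) + (Q ** C ** transpose Q) ** transpose N = Q ** R ** transpose Q"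
proof -
  have "N ** (Q ** C ** transpose Q) = Q ** (M ** C) ** transpose Q"
    by (metis assms(1) matrix_mul_assoc)
  moreover have "(Q ** C ** transpose Q) ** transpose N = Q ** (C ** transpose M) ** transpose Q"
    by (metis assms(1) matrix_mul_assoc matrix_transpose_mul)
  ultimately show ?thesis by (simp add: assms(2)[symmetric] matrix_add_ldistrib matrix_add_rdistrib)
qed

lemma inner_mat_mult: "a \<bullet> (A *v b) = (transpose A *v a) \<bullet> (b :: real ^ 'n)"
  by (simp add: dot_lmul_matrix)

text \<open>Tested on the real and imaginary parts of a left eigenvector, whose span is invariant
  under the row action of \<open>M\<close>, the matrix equation closes up to a scalar linear
  system.\<close>

lemma lyapunov_bilinear:
  fixes M C :: "real ^ 'n ^ 'n" and B :: "real ^ 'm ^ 'n"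
  assumes "M ** C + C ** transpose M = B ** transpose B"
  shows "(a v* M) \<bullet> (C *v b) + a \<bullet> (C *v (b v* M)) = (transpose B *v a) \<bullet> (transpose B *v b)"
proof -
  have "a \<bullet> ((M ** C + C ** transpose M) *v b) = (a v* M) \<bullet> (C *v b) + a \<bullet> (C *v (b v* M))"
    by (simp add: matrix_vector_mult_add_rdistrib inner_add_right matrix_vector_mul_assoc[symmetric] inner_mat_mult)
  then show ?thesis
    by (simp add: assms matrix_vector_mul_assoc[symmetric] inner_mat_mult)
qed

lemma psd_Cauchy_Schwarz:
  fixes C :: "real ^ 'n ^ 'n"
  assumes sym: "transpose C = C" and psd: "\<And>t. 0 \<le> t \<bullet> (C *v t)"
  shows "\<bar>a \<bullet> (C *v b)\<bar> \<le> sqrt (a \<bullet> (C *v a)) * sqrt (b \<bullet> (C *v b))"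
proof -
  define p q r where "p = a \<bullet> (C *v a)" and "q = b \<bullet> (C *v b)" and "r = a \<bullet> (C *v b)"
  have ba: "b \<bullet> (C *v a) = r" unfolding r_def by (subst inner_mat_mult) (simp add: sym inner_commute)
  have "0 \<le> p + 2 * x * r + x\<^sup>2 * q" for x
    using psd[of "a + x *\<^sub>R b"] ba
    by (simp add: p_def q_def r_def matrix_vector_right_distrib inner_add_left inner_add_right
        matrix_vector_mult_scaleR power2_eq_square algebra_simps)
  have nn: "p \<ge> 0" "q \<ge> 0" using psd by (auto simp: p_def q_def)
  have "r\<^sup>2 \<le> p * q"
  proof (cases "q = 0")
    case True
    have "r = 0"
    proof (rule ccontr)
      assume "r \<noteq> 0"
      \<comment> \<open>For \<open>q = 0\<close> the quadratic in \<open>x\<close> is affine, and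
        \<open>x = - (p + 1) / (2 * r)\<close> is chosen to give it the value -1.\<close>
      then have "p + 2 * (- (p + 1) / (2 * r)) * r = - 1" by (simp add: field_simps)
      then show False using \<open>0 \<le> p + 2 * (- (p + 1) / (2 * r)) * r + (- (p + 1) / (2 * r))\<^sup>2 * q\<close> True by simp
    qed
    then show ?thesis using nn by simp
  next
    case False
    \<comment> \<open>\<open>- r / q\<close> minimizes the quadratic in \<open>x\<close>.\<close>
    have "0 \<le> p + 2 * (- r / q) * r + (- r / q)\<^sup>2 * q" by fact
    also have "\<dots> = p - r\<^sup>2 / q" using False by (simp add: field_simps power2_eq_square)
    finally show ?thesis using False nn by (simp add: field_simps)
  qed
  then have "sqrt (r\<^sup>2) \<le> sqrt (p * q)" by (rule real_sqrt_le_mono)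
  then show ?thesis by (simp add: real_sqrt_mult p_def q_def r_def)
qed

lemma Re_Im_left_eigenvector:
  assumes "left_eigenvector (complex_matrix M) w (Complex \<eta> \<Omega>)"
  shows "Re_vec w v* M = \<eta> *\<^sub>R Re_vec w - \<Omega> *\<^sub>R Im_vec w"
    and "Im_vec w v* M = \<Omega> *\<^sub>R Re_vec w + \<eta> *\<^sub>R Im_vec w"
proof -
  have *: "(w v* complex_matrix M) $ j = Complex \<eta> \<Omega> * w $ j" for j
    using assms by (simp add: left_eigenvector_def)
  show "Re_vec w v* M = \<eta> *\<^sub>R Re_vec w - \<Omega> *\<^sub>R Im_vec w"
    using arg_cong[OF *, of Re] by (simp add: vec_eq_iff vector_matrix_mult_def Re_vec_def Im_vec_def)
  show "Im_vec w v* M = \<Omega> *\<^sub>R Re_vec w + \<eta> *\<^sub>R Im_vec w"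
    using arg_cong[OF *, of Im] by (simp add: vec_eq_iff vector_matrix_mult_def Re_vec_def Im_vec_def algebra_simps)
qed

text \<open>Real form of \<open>2 \<lambda> (w\<^sup>T C w) = w\<^sup>T B B\<^sup>T w\<close> and \<open>2 \<eta> (w\<^sup>* C w) = \<sigma>\<^sup>2\<close>, where \<open>\<lambda> = \<eta> + \<i> \<Omega>\<close> and \<open>w = a + \<i> b\<close>: only the
  second is singular as \<open>\<eta> \<rightarrow> 0\<close>.\<close>

lemma hopf_covariance_solve:
  fixes M C :: "real ^ 'n ^ 'n" and B :: "real ^ 'm ^ 'n"
  assumes lyap: "M ** C + C ** transpose M = B ** transpose B" and sym: "transpose C = C"
    and w: "left_eigenvector (complex_matrix M) w (Complex \<eta> \<Omega>)" and pos: "\<eta> > 0"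
  defines "a \<equiv> Re_vec w" and "b \<equiv> Im_vec w"
  defines "baa \<equiv> (norm (transpose B *v a))\<^sup>2" and "bbb \<equiv> (norm (transpose B *v b))\<^sup>2"
    and "bab \<equiv> (transpose B *v a) \<bullet> (transpose B *v b)"
  shows "\<eta> * (a \<bullet> (C *v a)) = (baa + bbb) / 4 + \<eta> * (\<eta> * (baa - bbb) + 2 * \<Omega> * bab) / (4 * (\<eta>\<^sup>2 + \<Omega>\<^sup>2))" (is ?aa)
    and "\<eta> * (b \<bullet> (C *v b)) = (baa + bbb) / 4 - \<eta> * (\<eta> * (baa - bbb) + 2 * \<Omega> * bab) / (4 * (\<eta>\<^sup>2 + \<Omega>\<^sup>2))" (is ?bb)
    and "\<eta> * (a \<bullet> (C *v b)) = \<eta> * (2 * \<eta> * bab - \<Omega> * (baa - bbb)) / (4 * (\<eta>\<^sup>2 + \<Omega>\<^sup>2))" (is ?ab)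
proof -
  define p q r where "p = a \<bullet> (C *v a)" and "q = b \<bullet> (C *v b)" and "r = a \<bullet> (C *v b)"
  have ba: "b \<bullet> (C *v a) = r" unfolding r_def by (subst inner_mat_mult) (simp add: sym inner_commute)
  note wM = Re_Im_left_eigenvector[OF w, folded a_def b_def]
  have e1: "2 * \<eta> * p - 2 * \<Omega> * r = baa"
    using lyapunov_bilinear[OF lyap, of a a] ba
    by (simp add: wM p_def r_def baa_def power2_norm_eq_inner inner_diff_left inner_diff_right
        matrix_vector_mult_diff_distrib matrix_vector_mult_scaleR algebra_simps)
  have e2: "2 * \<eta> * q + 2 * \<Omega> * r = bbb"
    using lyapunov_bilinear[OF lyap, of b b] ba
    by (simp add: wM q_def r_def bbb_def power2_norm_eq_inner inner_add_left inner_add_right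
        matrix_vector_right_distrib matrix_vector_mult_scaleR algebra_simps)
  have e3: "2 * \<eta> * r + \<Omega> * p - \<Omega> * q = bab"
    using lyapunov_bilinear[OF lyap, of a b] ba
    by (simp add: wM p_def q_def r_def bab_def inner_add_left inner_add_right inner_diff_left
        matrix_vector_right_distrib matrix_vector_mult_scaleR algebra_simps)
  have D: "\<eta>\<^sup>2 + \<Omega>\<^sup>2 > 0" using pos by (simp add: add_pos_nonneg)
  \<comment> \<open>\<open>e1 - e2\<close> and \<open>e3\<close> form a closed system for
    \<open>p - q\<close> and \<open>r\<close> with determinant proportional to
    \<open>\<eta>\<^sup>2 + \<Omega>\<^sup>2\<close>, harmless for small \<eta> when \<Omega> is not
    small. Only \<open>p + q\<close> requires division by \<eta>.\<close>
  have pq: "(p - q) * (2 * (\<eta>\<^sup>2 + \<Omega>\<^sup>2)) = \<eta> * (baa - bbb) + 2 * \<Omega> * bab"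
    unfolding e1[symmetric] e2[symmetric] e3[symmetric] by (simp add: power2_eq_square algebra_simps)
  have r: "r * (4 * (\<eta>\<^sup>2 + \<Omega>\<^sup>2)) = 2 * \<eta> * bab - \<Omega> * (baa - bbb)"
    unfolding e1[symmetric] e2[symmetric] e3[symmetric] by (simp add: power2_eq_square algebra_simps)
  have s: "baa + bbb = 2 * \<eta> * (p + q)" using e1 e2 by (simp add: algebra_simps)
  have half: "\<eta> * (\<eta> * (baa - bbb) + 2 * \<Omega> * bab) / (4 * (\<eta>\<^sup>2 + \<Omega>\<^sup>2)) = \<eta> * (p - q) / 2"
    unfolding pq[symmetric] using D by (simp add: field_simps)
  show ?aa ?bb unfolding p_def[symmetric] q_def[symmetric] half s by (simp_all add: field_simps)
  show ?ab unfolding r_def[symmetric] r[symmetric] using D by (simp add: field_simps)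
qed

text \<open>The Jacobian in the state variable is the joint derivative in the directions
  \<open>(axis j 1, 0)\<close>. The joint derivative is itself differentiable, hence continuous at
  the endpoint; this provides the limit of \<open>M\<close>.\<close>

lemma C2_on_jacobian_tendsto:
  fixes F :: "real ^ 'n \<Rightarrow> real \<Rightarrow> real ^ 'k"
  assumes C2: "C2_on (\<lambda>(y, \<alpha>). F y \<alpha>) U" and U: "(y0, \<alpha>0) \<in> U"
    and lim: "(y \<longlongrightarrow> y0) (at \<alpha>0 within T)"
    and ev: "\<forall>\<^sub>F \<alpha> in at \<alpha>0 within T. (y \<alpha>, \<alpha>) \<in> U"
  shows "((\<lambda>\<alpha>. jacobian (\<lambda>z. F z \<alpha>) (at (y \<alpha>)) $ i $ j) \<longlongrightarrow> jacobian (\<lambda>z. F z \<alpha>0) (at y0) $ i $ j) (at \<alpha>0 within T)"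
proof -
  from C2 obtain f' :: "(real ^ 'n) \<times> real \<Rightarrow> ((real ^ 'n) \<times> real) \<Rightarrow>\<^sub>L (real ^ 'k)" and f''
    where f': "\<And>p. p \<in> U \<Longrightarrow> ((\<lambda>(y, \<alpha>). F y \<alpha>) has_derivative blinfun_apply (f' p)) (at p)"
      and f'': "\<And>p. p \<in> U \<Longrightarrow> (f' has_derivative blinfun_apply (f'' p)) (at p)"
    unfolding C2_on_def by blast
  have J: "jacobian (\<lambda>z. F z \<alpha>) (at a) $ i $ j = f' (a, \<alpha>) (axis j 1, 0) $ i" if "(a, \<alpha>) \<in> U" for a \<alpha>
  proof -
    have "((\<lambda>z. (z, \<alpha>)) has_derivative (\<lambda>h. (h, 0))) (at a)"
      by (auto intro!: derivative_eq_intros)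
    from has_derivative_compose[OF this f'[OF that]]
    have "((\<lambda>z. F z \<alpha>) has_derivative (\<lambda>h. f' (a, \<alpha>) (h, 0))) (at a)" by simp
    then show ?thesis by (simp add: jacobian_def matrix_def frechet_derivative_at[symmetric])
  qed
  have "isCont f' (y0, \<alpha>0)" using f''[OF U] by (rule has_derivative_continuous)
  moreover have "((\<lambda>\<alpha>. (y \<alpha>, \<alpha>)) \<longlongrightarrow> (y0, \<alpha>0)) (at \<alpha>0 within T)"
    by (intro tendsto_Pair lim tendsto_ident_at)
  ultimately have "((\<lambda>\<alpha>. f' (y \<alpha>, \<alpha>)) \<longlongrightarrow> f' (y0, \<alpha>0)) (at \<alpha>0 within T)"
    by (rule isCont_tendsto_compose)
  then have "((\<lambda>\<alpha>. f' (y \<alpha>, \<alpha>) (axis j 1, 0) $ i) \<longlongrightarrow> f' (y0, \<alpha>0) (axis j 1, 0) $ i) (at \<alpha>0 within T)"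
    by (intro tendsto_intros)
  moreover have "\<forall>\<^sub>F \<alpha> in at \<alpha>0 within T. f' (y \<alpha>, \<alpha>) (axis j 1, 0) $ i = jacobian (\<lambda>z. F z \<alpha>) (at (y \<alpha>)) $ i $ j"
    using ev by eventually_elim (simp add: J)
  ultimately show ?thesis unfolding J[OF U] by (rule Lim_transform_eventually)
qed

section \<open>The limit of the scaled covariance\<close>

lemma tendsto_Re_Im_vec:
  assumes "(v \<longlongrightarrow> vc) F"
  shows "((\<lambda>x. Re_vec (v x)) \<longlongrightarrow> Re_vec vc) F" "((\<lambda>x. Im_vec (v x)) \<longlongrightarrow> Im_vec vc) F"
  unfolding Re_vec_def Im_vec_def by (intro tendsto_intros assms)+

lemma norm_complex_matrix_mult:
  "(norm (complex_matrix A *v w))\<^sup>2 = (norm (A *v Re_vec w))\<^sup>2 + (norm (A *v Im_vec w))\<^sup>2"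
proof -
  have "(norm z)\<^sup>2 = (norm (Re_vec z))\<^sup>2 + (norm (Im_vec z))\<^sup>2" for z :: "complex ^ 'k"
    by (simp add: norm_vec_def L2_set_def sum_nonneg Re_vec_def Im_vec_def cmod_power2 sum.distrib)
  moreover have "Re_vec (complex_matrix A *v w) = A *v Re_vec w" "Im_vec (complex_matrix A *v w) = A *v Im_vec w"
    by (simp_all add: vec_eq_iff Re_vec_def Im_vec_def matrix_vector_mult_def)
  ultimately show ?thesis by metis
qed

lemma inner_conj_quadratic_form:
  fixes Q C :: "real ^ 'n ^ 'n"
  shows "t \<bullet> ((Q ** C ** transpose Q) *v t) = (transpose Q *v t) \<bullet> (C *v (transpose Q *v t))"
  by (simp add: matrix_vector_mul_assoc[symmetric] inner_mat_mult del: transpose_matrix_vector)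

lemma tendsto_quadratic_form:
  fixes X :: "'i \<Rightarrow> real ^ 'n ^ 'n"
  assumes "\<And>i j. ((\<lambda>x. X x $ i $ j) \<longlongrightarrow> Xc $ i $ j) F"
  shows "((\<lambda>x. t \<bullet> (X x *v t)) \<longlongrightarrow> t \<bullet> (Xc *v t)) F"
  unfolding inner_vec_def matrix_vector_mult_def by (simp, intro tendsto_intros assms)

text \<open>The covariance splits into its part along the critical pair, which is solved for explicitly and
  grows like \<open>1 / \<eta>\<close>, and the complementary part, which converges; the cross terms are then
  negligible by Cauchy--Schwarz.\<close>

lemma hopf_covariance_limit:
  fixes M C :: "'i \<Rightarrow> real ^ 'n ^ 'n" and B :: "real ^ 'm ^ 'n" and v w :: "'i \<Rightarrow> complex ^ 'n"
  assumes M: "\<And>i j. ((\<lambda>x. M x $ i $ j) \<longlongrightarrow> Mc $ i $ j) F"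
    and lyap: "\<forall>\<^sub>F x in F. M x ** C x + C x ** transpose (M x) = B ** transpose B"
    and C: "\<forall>\<^sub>F x in F. transpose (C x) = C x \<and> (\<forall>t. 0 \<le> t \<bullet> (C x *v t))"
    and diag: "\<forall>\<^sub>F x in F. diagonalizable (complex_matrix (M x))"
    and pair: "\<forall>\<^sub>F x in F. simple_eigenvalue (complex_matrix (M x)) (Complex (\<eta> x) (\<Omega> x)) \<and>
      simple_eigenvalue (complex_matrix (M x)) (Complex (\<eta> x) (- \<Omega> x))"
    and eta: "\<forall>\<^sub>F x in F. \<eta> x > 0" "(\<eta> \<longlongrightarrow> 0) F"
    and Omega: "(\<Omega> \<longlongrightarrow> \<Omega>c) F" "\<Omega>c > 0"
    and gap: "\<delta> > 0" "\<forall>\<^sub>F x in F. \<forall>k. eigenvalue (complex_matrix (M x)) k \<and>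
      k \<noteq> Complex (\<eta> x) (\<Omega> x) \<and> k \<noteq> Complex (\<eta> x) (- \<Omega> x) \<longrightarrow> Re k \<ge> \<delta>"
    and right: "\<forall>\<^sub>F x in F. right_eigenvector (complex_matrix (M x)) (v x) (Complex (\<eta> x) (\<Omega> x)) \<and>
      right_eigenvector (complex_matrix (M x)) (cnj_vec (v x)) (Complex (\<eta> x) (- \<Omega> x))"
    and left: "\<forall>\<^sub>F x in F. left_eigenvector (complex_matrix (M x)) (w x) (Complex (\<eta> x) (\<Omega> x)) \<and>
      left_eigenvector (complex_matrix (M x)) (cnj_vec (w x)) (Complex (\<eta> x) (- \<Omega> x))"
    and wv: "\<forall>\<^sub>F x in F. scalar_product (w x) (v x) = 1"
    and lim: "(v \<longlongrightarrow> vc) F" "(w \<longlongrightarrow> wc) F"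
    and sigma: "((\<lambda>x. (norm (complex_matrix (transpose B) *v w x))\<^sup>2) \<longlongrightarrow> s) F" "s > 0"
  shows "((\<lambda>x. \<eta> x / (norm (complex_matrix (transpose B) *v w x))\<^sup>2 * (t \<bullet> (C x *v t))) \<longlongrightarrow>
    (t \<bullet> Re_vec vc)\<^sup>2 + (t \<bullet> Im_vec vc)\<^sup>2) F"
proof -
  define a b where "a = (\<lambda>x. Re_vec (w x))" and "b = (\<lambda>x. Im_vec (w x))"
  define \<sigma>2 where "\<sigma>2 = (\<lambda>x. (norm (complex_matrix (transpose B) *v w x))\<^sup>2)"
  define P where "P = (\<lambda>x. hopf_projection (v x) (w x))"
  define Q where "Q = (\<lambda>x. mat 1 - P x)"
  define X where "X = (\<lambda>x. Q x ** C x ** transpose (Q x))"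
  define R where "R = (\<lambda>x. Q x ** (B ** transpose B) ** transpose (Q x))"
  define N where "N = (\<lambda>x. M x + \<delta> *\<^sub>R P x)"
  define Pc where "Pc = hopf_projection vc wc"
  define Qc where "Qc = mat 1 - Pc"
  have Omega_nz: "\<forall>\<^sub>F x in F. \<Omega> x \<noteq> 0"
    using order_tendstoD(1)[OF Omega] by eventually_elim simp
  have P_lim: "((\<lambda>x. P x $ i $ j) \<longlongrightarrow> Pc $ i $ j) F" for i j
    unfolding P_def Pc_def hopf_projection_def by (simp, intro tendsto_intros lim)
  have Q_lim: "((\<lambda>x. Q x $ i $ j) \<longlongrightarrow> Qc $ i $ j) F" for i j
    unfolding Q_def Qc_def by (simp, intro tendsto_intros P_lim)
  have N_lim: "((\<lambda>x. N x $ i $ j) \<longlongrightarrow> (Mc + \<delta> *\<^sub>R Pc) $ i $ j) F" for i j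
    unfolding N_def by (simp, intro tendsto_intros P_lim M)
  have R_lim: "((\<lambda>x. R x $ i $ j) \<longlongrightarrow> (Qc ** (B ** transpose B) ** transpose Qc) $ i $ j) F" for i j
    unfolding R_def matrix_matrix_mult_def transpose_def by (simp, intro tendsto_intros Q_lim)
  have defl: "\<forall>\<^sub>F x in F. (\<exists>(S :: complex ^ 'n ^ 'n) S' d. S ** S' = mat 1 \<and>
      complex_matrix (N x) = S ** diag_mat d ** S' \<and> (\<forall>k. Re (d k) \<ge> \<delta>)) \<and>
      N x ** X x + X x ** transpose (N x) = R x"
    using diag pair eta(1) Omega_nz gap(2) right left wv lyap
  proof eventually_elim
    case (elim x)
    obtain S S' :: "complex ^ 'n ^ 'n" and d where *: "S ** S' = mat 1"
      "complex_matrix (M x + \<delta> *\<^sub>R hopf_projection (v x) (w x)) = S ** diag_mat d ** S'" "\<And>k. Re (d k) \<ge> \<delta>"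
      "(M x + \<delta> *\<^sub>R hopf_projection (v x) (w x)) ** (mat 1 - hopf_projection (v x) (w x)) =
        (mat 1 - hopf_projection (v x) (w x)) ** M x"
      by (rule hopf_deflation[of "M x" "\<eta> x" "\<Omega> x" \<delta> "v x" "w x"]) (use elim in auto)
    have "N x ** X x + X x ** transpose (N x) = R x"
      unfolding X_def R_def by (rule lyapunov_conj[OF _ elim(9)]) (use *(4) in \<open>simp add: N_def Q_def P_def\<close>)
    moreover have "complex_matrix (N x) = S ** diag_mat d ** S'" using *(2) by (simp add: N_def P_def)
    ultimately show ?case using *(1,3) by blast
  qed
  \<comment> \<open>The diagonalization is complex, so the convergence result is applied to the
    complexified equation; real parts then recover the limit of \<open>X\<close>.\<close>
  have "\<exists>Xc. \<forall>i j. ((\<lambda>x. complex_matrix (X x) $ i $ j) \<longlongrightarrow> Xc $ i $ j) F"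
  proof (rule lyapunov_solution_convergent)
    show "((\<lambda>x. complex_matrix (N x) $ i $ j) \<longlongrightarrow> complex_matrix (Mc + \<delta> *\<^sub>R Pc) $ i $ j) F" for i j
      unfolding complex_matrix_nth by (intro tendsto_of_real N_lim)
    show "((\<lambda>x. complex_matrix (R x) $ i $ j) \<longlongrightarrow> complex_matrix (Qc ** (B ** transpose B) ** transpose Qc) $ i $ j) F" for i j
      unfolding complex_matrix_nth by (intro tendsto_of_real R_lim)
    show "\<forall>\<^sub>F x in F. \<exists>(S :: complex ^ 'n ^ 'n) S' d. S ** S' = mat 1 \<and>
      complex_matrix (N x) = S ** diag_mat d ** S' \<and> (\<forall>k. Re (d k) \<ge> \<delta>)"
      using defl by eventually_elim blast
    show "\<forall>\<^sub>F x in F. complex_matrix (N x) ** complex_matrix (X x) +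
        complex_matrix (X x) ** transpose (complex_matrix (N x)) = complex_matrix (R x)"
      using defl by eventually_elim (simp only: complex_matrix_simps[symmetric])
  qed (fact gap(1))
  then obtain Xc where Xc: "\<And>i j. ((\<lambda>x. complex_matrix (X x) $ i $ j) \<longlongrightarrow> Xc $ i $ j) F" by blast
  have "((\<lambda>x. X x $ i $ j) \<longlongrightarrow> (\<chi> i j. Re (Xc $ i $ j)) $ i $ j) F" for i j
    using tendsto_Re[OF Xc[of i j]] by simp
  from tendsto_quadratic_form[OF this, of t]
  have X_lim: "((\<lambda>x. t \<bullet> (X x *v t)) \<longlongrightarrow> t \<bullet> ((\<chi> i j. Re (Xc $ i $ j)) *v t)) F" .

  have \<sigma>2: "\<sigma>2 x = (norm (transpose B *v a x))\<^sup>2 + (norm (transpose B *v b x))\<^sup>2" for x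
    unfolding \<sigma>2_def a_def b_def by (rule norm_complex_matrix_mult)
  have \<sigma>2_lim: "(\<sigma>2 \<longlongrightarrow> s) F" using sigma(1) unfolding \<sigma>2_def .
  have \<sigma>2_pos: "\<forall>\<^sub>F x in F. \<sigma>2 x > 0" by (rule order_tendstoD(1)[OF \<sigma>2_lim sigma(2)])
  have ab_lim: "(a \<longlongrightarrow> Re_vec wc) F" "(b \<longlongrightarrow> Im_vec wc) F"
    unfolding a_def b_def by (intro tendsto_Re_Im_vec lim)+
  have B_lim: "((\<lambda>x. transpose B *v a x) \<longlongrightarrow> transpose B *v Re_vec wc) F"
    "((\<lambda>x. transpose B *v b x) \<longlongrightarrow> transpose B *v Im_vec wc) F"
    by (intro bounded_linear.tendsto[OF matrix_vector_mul_bounded_linear] ab_lim)+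
  define D where "D = (\<lambda>x. (norm (transpose B *v a x))\<^sup>2 - (norm (transpose B *v b x))\<^sup>2)"
  define E where "E = (\<lambda>x. (transpose B *v a x) \<bullet> (transpose B *v b x))"
  \<comment> \<open>\<open>f\<close> and \<open>g\<close> are the nonsingular terms of the explicit
    solution: \<eta> times quotients whose denominators tend to
    \<open>4 * \<Omega>c\<^sup>2 > 0\<close>, hence vanishing in the limit.\<close>
  define f where "f = (\<lambda>x. \<eta> x * (\<eta> x * D x + 2 * \<Omega> x * E x) / (4 * ((\<eta> x)\<^sup>2 + (\<Omega> x)\<^sup>2)))"
  define g where "g = (\<lambda>x. \<eta> x * (2 * \<eta> x * E x - \<Omega> x * D x) / (4 * ((\<eta> x)\<^sup>2 + (\<Omega> x)\<^sup>2)))"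
  have DE: "(D \<longlongrightarrow> (norm (transpose B *v Re_vec wc))\<^sup>2 - (norm (transpose B *v Im_vec wc))\<^sup>2) F"
    "(E \<longlongrightarrow> (transpose B *v Re_vec wc) \<bullet> (transpose B *v Im_vec wc)) F"
    unfolding D_def E_def by (intro tendsto_intros B_lim)+
  have f: "(f \<longlongrightarrow> 0) F"
    unfolding f_def by (rule tendsto_eq_intros eta(2) Omega(1) DE refl)+ (use Omega(2) in auto)
  have g: "(g \<longlongrightarrow> 0) F"
    unfolding g_def by (rule tendsto_eq_intros eta(2) Omega(1) DE refl)+ (use Omega(2) in auto)
  \<comment> \<open>\<open>r x\<close> is \<open>transpose (P x) *v t\<close>, the critical part of
    \<open>t\<close>; the vector \<open>u x\<close> below is the complementary part, and
    \<open>t = u x + r x\<close>.\<close>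
  define r where "r = (\<lambda>x. (2 * (t \<bullet> Re_vec (v x))) *\<^sub>R a x - (2 * (t \<bullet> Im_vec (v x))) *\<^sub>R b x)"
  define \<kappa> where "\<kappa> = (\<lambda>x. \<eta> x / \<sigma>2 x)"
  define p q where "p = (\<lambda>x. t \<bullet> Re_vec (v x))" and "q = (\<lambda>x. t \<bullet> Im_vec (v x))"
  have pq_lim: "(p \<longlongrightarrow> t \<bullet> Re_vec vc) F" "(q \<longlongrightarrow> t \<bullet> Im_vec vc) F"
    unfolding p_def q_def by (intro tendsto_intros tendsto_Re_Im_vec lim)+
  have rCr: "((\<lambda>x. \<kappa> x * (r x \<bullet> (C x *v r x))) \<longlongrightarrow> (t \<bullet> Re_vec vc)\<^sup>2 + (t \<bullet> Im_vec vc)\<^sup>2) F"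
  proof (rule Lim_transform_eventually)
    \<comment> \<open>The 4 is the square of the factor 2 in \<open>r\<close> and cancels the 1/4 in
      the leading term \<open>\<sigma>2 x / 4\<close>.\<close>
    show "((\<lambda>x. 4 * ((p x)\<^sup>2 * (\<sigma>2 x / 4 + f x) - 2 * p x * q x * g x + (q x)\<^sup>2 * (\<sigma>2 x / 4 - f x)) / \<sigma>2 x)
        \<longlongrightarrow> (t \<bullet> Re_vec vc)\<^sup>2 + (t \<bullet> Im_vec vc)\<^sup>2) F"
    proof -
      have "((\<lambda>x. 4 * ((p x)\<^sup>2 * (\<sigma>2 x / 4 + f x) - 2 * p x * q x * g x + (q x)\<^sup>2 * (\<sigma>2 x / 4 - f x)) / \<sigma>2 x)
        \<longlongrightarrow> 4 * ((t \<bullet> Re_vec vc)\<^sup>2 * (s / 4 + 0) - 2 * (t \<bullet> Re_vec vc) * (t \<bullet> Im_vec vc) * 0 +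
          (t \<bullet> Im_vec vc)\<^sup>2 * (s / 4 - 0)) / s) F"
        by (intro tendsto_intros pq_lim f g \<sigma>2_lim) (use sigma(2) in auto)
      also have "4 * ((t \<bullet> Re_vec vc)\<^sup>2 * (s / 4 + 0) - 2 * (t \<bullet> Re_vec vc) * (t \<bullet> Im_vec vc) * 0 +
          (t \<bullet> Im_vec vc)\<^sup>2 * (s / 4 - 0)) / s = (t \<bullet> Re_vec vc)\<^sup>2 + (t \<bullet> Im_vec vc)\<^sup>2"
        using sigma(2) by (simp add: field_simps)
      finally show ?thesis .
    qed
    show "\<forall>\<^sub>F x in F. 4 * ((p x)\<^sup>2 * (\<sigma>2 x / 4 + f x) - 2 * p x * q x * g x + (q x)\<^sup>2 * (\<sigma>2 x / 4 - f x)) / \<sigma>2 x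
        = \<kappa> x * (r x \<bullet> (C x *v r x))"
      using lyap C left eta(1) \<sigma>2_pos
    proof eventually_elim
      case (elim x)
      have sym: "transpose (C x) = C x" and w: "left_eigenvector (complex_matrix (M x)) (w x) (Complex (\<eta> x) (\<Omega> x))"
        using elim by auto
      have solve: "\<eta> x * (a x \<bullet> (C x *v a x)) = \<sigma>2 x / 4 + f x"
        "\<eta> x * (b x \<bullet> (C x *v b x)) = \<sigma>2 x / 4 - f x" "\<eta> x * (a x \<bullet> (C x *v b x)) = g x"
        using hopf_covariance_solve[OF elim(1) sym w elim(4)]
        by (simp_all only: a_def b_def D_def E_def \<sigma>2 f_def g_def)
      have ba: "b x \<bullet> (C x *v a x) = a x \<bullet> (C x *v b x)"
        by (subst inner_mat_mult) (simp add: sym inner_commute del: transpose_matrix_vector)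
      have "\<eta> x * (r x \<bullet> (C x *v r x)) = 4 * ((p x)\<^sup>2 * (\<eta> x * (a x \<bullet> (C x *v a x)))
          - 2 * p x * q x * (\<eta> x * (a x \<bullet> (C x *v b x))) + (q x)\<^sup>2 * (\<eta> x * (b x \<bullet> (C x *v b x))))"
        by (simp add: r_def p_def q_def matrix_vector_mult_diff_distrib matrix_vector_mult_scaleR inner_diff_left inner_diff_right
            ba power2_eq_square algebra_simps)
      then show ?case unfolding solve \<kappa>_def by simp
    qed
  qed
  define u where "u = (\<lambda>x. transpose (Q x) *v t)"
  have \<kappa>0: "(\<kappa> \<longlongrightarrow> 0) F"
    unfolding \<kappa>_def by (rule tendsto_eq_intros eta(2) \<sigma>2_lim refl)+ (use sigma(2) in auto)
  have uCu: "((\<lambda>x. \<kappa> x * (u x \<bullet> (C x *v u x))) \<longlongrightarrow> 0) F"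
    using tendsto_mult[OF \<kappa>0 X_lim] unfolding X_def inner_conj_quadratic_form u_def by simp
  have uCr: "((\<lambda>x. \<kappa> x * (u x \<bullet> (C x *v r x))) \<longlongrightarrow> 0) F"
  proof (rule Lim_null_comparison)
    \<comment> \<open>With \<open>\<kappa>\<close> shared between the two roots, one factor tends to
      zero and the other to a finite limit.\<close>
    show "((\<lambda>x. sqrt (\<kappa> x * (u x \<bullet> (C x *v u x))) * sqrt (\<kappa> x * (r x \<bullet> (C x *v r x)))) \<longlongrightarrow> 0) F"
      using tendsto_mult[OF tendsto_real_sqrt[OF uCu] tendsto_real_sqrt[OF rCr]] by simp
    show "\<forall>\<^sub>F x in F. norm (\<kappa> x * (u x \<bullet> (C x *v r x))) \<le>
        sqrt (\<kappa> x * (u x \<bullet> (C x *v u x))) * sqrt (\<kappa> x * (r x \<bullet> (C x *v r x)))"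
      using C eta(1) \<sigma>2_pos
    proof eventually_elim
      case (elim x)
      have k: "\<kappa> x > 0" using elim by (simp add: \<kappa>_def)
      have "\<kappa> x * \<bar>u x \<bullet> (C x *v r x)\<bar> \<le> \<kappa> x * (sqrt (u x \<bullet> (C x *v u x)) * sqrt (r x \<bullet> (C x *v r x)))"
        using elim k by (intro mult_left_mono psd_Cauchy_Schwarz) auto
      also have "\<dots> = sqrt (\<kappa> x * (u x \<bullet> (C x *v u x))) * sqrt (\<kappa> x * (r x \<bullet> (C x *v r x)))"
        using k by (simp add: real_sqrt_mult algebra_simps)
      finally show ?case using k by (simp add: abs_mult)
    qed
  qed
  show ?thesis
  proof (rule Lim_transform_eventually)
    show "((\<lambda>x. \<kappa> x * (u x \<bullet> (C x *v u x)) + 2 * (\<kappa> x * (u x \<bullet> (C x *v r x))) + \<kappa> x * (r x \<bullet> (C x *v r x)))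
        \<longlongrightarrow> (t \<bullet> Re_vec vc)\<^sup>2 + (t \<bullet> Im_vec vc)\<^sup>2) F"
      using tendsto_add[OF tendsto_add[OF uCu tendsto_mult[OF tendsto_const[of 2] uCr]] rCr] by simp
    show "\<forall>\<^sub>F x in F. \<kappa> x * (u x \<bullet> (C x *v u x)) + 2 * (\<kappa> x * (u x \<bullet> (C x *v r x))) + \<kappa> x * (r x \<bullet> (C x *v r x))
        = \<eta> x / (norm (complex_matrix (transpose B) *v w x))\<^sup>2 * (t \<bullet> (C x *v t))"
      using C
    proof eventually_elim
      case (elim x)
      have ru: "r x \<bullet> (C x *v u x) = u x \<bullet> (C x *v r x)"
        by (subst inner_mat_mult) (use elim in \<open>simp add: inner_commute del: transpose_matrix_vector\<close>)
      have "transpose (Q x) = mat 1 - transpose (P x)"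
        by (simp add: Q_def transpose_def vec_eq_iff mat_def)
      then have "t = u x + r x"
        by (simp add: u_def r_def matrix_vector_mult_diff_rdistrib P_def transpose_hopf_projection_mult a_def b_def
            del: transpose_matrix_vector)
      then have "t \<bullet> (C x *v t) = (u x + r x) \<bullet> (C x *v (u x + r x))" by simp
      also have "\<dots> = u x \<bullet> (C x *v u x) + 2 * (u x \<bullet> (C x *v r x)) + r x \<bullet> (C x *v r x)"
        by (simp add: matrix_vector_right_distrib inner_add_left inner_add_right ru)
      finally show ?case unfolding \<kappa>_def \<sigma>2_def by (simp add: algebra_simps)
    qed
  qed
qed

theorem theoremE4:
  fixes F :: "real ^ 'n \<Rightarrow> real \<Rightarrow> real ^ 'n"
    and B :: "real ^ 'm ^ 'n"
    and xs :: "real \<Rightarrow> real ^ 'n" and xc :: "real ^ 'n"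
    and \<alpha>0 \<alpha>c :: real
    and U :: "((real ^ 'n) \<times> real) set"
    and M C :: "real \<Rightarrow> real ^ 'n ^ 'n"
    and \<eta> \<Omega> :: "real \<Rightarrow> real" and \<Omega>c \<delta> :: real
    and vH wH :: "real \<Rightarrow> complex ^ 'n" and vHc wHc :: "complex ^ 'n"
    and \<sigma>H :: "real \<Rightarrow> real" and \<sigma>Hc :: real
    and W :: "real \<Rightarrow> 'w measure" and z x :: "real \<Rightarrow> 'w \<Rightarrow> real ^ 'n"
    and V :: "'v measure" and G1 G2 :: "'v \<Rightarrow> real" and uH :: "'v \<Rightarrow> real ^ 'n"
  assumes N: "CARD('n) \<ge> 2"
    \<comment> \<open>equilibrium branch, linearization and Lyapunov equation\<close>
    and range: "\<alpha>0 < \<alpha>c"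
    and stable: "\<And>\<alpha>. \<alpha> \<in> {\<alpha>0<..<\<alpha>c} \<Longrightarrow> asymptotically_stable_equilibrium (\<lambda>y. F y \<alpha>) (xs \<alpha>)"
    and branch_limit: "(xs \<longlongrightarrow> xc) (at_left \<alpha>c)"
    and smooth: "open U" "(\<lambda>\<alpha>. (xs \<alpha>, \<alpha>)) ` {\<alpha>0<..<\<alpha>c} \<subseteq> U" "(xc, \<alpha>c) \<in> U"
      "C2_on (\<lambda>(y, \<alpha>). F y \<alpha>) U"
    and M: "\<And>\<alpha>. M \<alpha> = - jacobian (\<lambda>y. F y \<alpha>) (at (xs \<alpha>))"
    and lyapunov: "\<And>\<alpha>. \<alpha> \<in> {\<alpha>0<..<\<alpha>c} \<Longrightarrow>
      M \<alpha> ** C \<alpha> + C \<alpha> ** transpose (M \<alpha>) = B ** transpose B"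
    \<comment> \<open>simple Hopf pair\<close>
    and diag: "\<forall>\<^sub>F \<alpha> in at_left \<alpha>c. diagonalizable (complex_matrix (M \<alpha>))"
    and pair: "\<forall>\<^sub>F \<alpha> in at_left \<alpha>c.
      simple_eigenvalue (complex_matrix (M \<alpha>)) (Complex (\<eta> \<alpha>) (\<Omega> \<alpha>)) \<and>
      simple_eigenvalue (complex_matrix (M \<alpha>)) (Complex (\<eta> \<alpha>) (- \<Omega> \<alpha>))"
    and eta: "\<forall>\<^sub>F \<alpha> in at_left \<alpha>c. \<eta> \<alpha> > 0" "(\<eta> \<longlongrightarrow> 0) (at_left \<alpha>c)"
    and Omega: "(\<Omega> \<longlongrightarrow> \<Omega>c) (at_left \<alpha>c)" "\<Omega>c > 0"
    and gap: "\<delta> > 0" "\<forall>\<^sub>F \<alpha> in at_left \<alpha>c. \<forall>k. eigenvalue (complex_matrix (M \<alpha>)) k \<and>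
      k \<noteq> Complex (\<eta> \<alpha>) (\<Omega> \<alpha>) \<and> k \<noteq> Complex (\<eta> \<alpha>) (- \<Omega> \<alpha>) \<longrightarrow> Re k \<ge> \<delta>"
    and right: "\<forall>\<^sub>F \<alpha> in at_left \<alpha>c.
      right_eigenvector (complex_matrix (M \<alpha>)) (vH \<alpha>) (Complex (\<eta> \<alpha>) (\<Omega> \<alpha>)) \<and>
      right_eigenvector (complex_matrix (M \<alpha>)) (cnj_vec (vH \<alpha>)) (Complex (\<eta> \<alpha>) (- \<Omega> \<alpha>))"
    and left: "\<forall>\<^sub>F \<alpha> in at_left \<alpha>c.
      left_eigenvector (complex_matrix (M \<alpha>)) (wH \<alpha>) (Complex (\<eta> \<alpha>) (\<Omega> \<alpha>)) \<and>
      left_eigenvector (complex_matrix (M \<alpha>)) (cnj_vec (wH \<alpha>)) (Complex (\<eta> \<alpha>) (- \<Omega> \<alpha>))"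
    and normalization: "\<forall>\<^sub>F \<alpha> in at_left \<alpha>c. norm (vH \<alpha>) = 1 \<and>
      scalar_product (wH \<alpha>) (vH \<alpha>) = 1 \<and> scalar_product (wH \<alpha>) (cnj_vec (vH \<alpha>)) = 0"
    and eigenvector_limits: "(vH \<longlongrightarrow> vHc) (at_left \<alpha>c)" "(wH \<longlongrightarrow> wHc) (at_left \<alpha>c)"
    \<comment> \<open>effective noise amplitude\<close>
    and sigma: "\<And>\<alpha>. \<sigma>H \<alpha> = norm (complex_matrix (transpose B) *v wH \<alpha>)"
    and sigma_limit: "((\<lambda>\<alpha>. (\<sigma>H \<alpha>)\<^sup>2) \<longlongrightarrow> \<sigma>Hc\<^sup>2) (at_left \<alpha>c)" "\<sigma>Hc\<^sup>2 > 0"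
    \<comment> \<open>random vectors\<close>
    and z: "\<And>\<alpha>. \<alpha> \<in> {\<alpha>0<..<\<alpha>c} \<Longrightarrow> normal_random_vector (W \<alpha>) (z \<alpha>) 0 (C \<alpha>)"
    and x: "\<And>\<alpha> \<omega>. x \<alpha> \<omega> = xs \<alpha> + z \<alpha> \<omega>"
    and V: "prob_space V"
    and G: "distributed V lborel G1 std_normal_density" "distributed V lborel G2 std_normal_density"
      "prob_space.indep_var V borel G1 borel G2"
    and uH: "\<And>\<omega>. uH \<omega> = G1 \<omega> *\<^sub>R Re_vec vHc + G2 \<omega> *\<^sub>R Im_vec vHc"
  shows "converges_in_distribution W (\<lambda>\<alpha> \<omega>. (sqrt (\<eta> \<alpha>) / \<sigma>H \<alpha>) *\<^sub>R (x \<alpha> \<omega> - xs \<alpha>))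
           V uH (at_left \<alpha>c) \<and>
         converges_in_distribution W (\<lambda>\<alpha> \<omega>. (sqrt (\<eta> \<alpha>) / \<sigma>H \<alpha>) *\<^sub>R (centering_matrix *v x \<alpha> \<omega>))
           V (\<lambda>\<omega>. centering_matrix *v uH \<omega>) (at_left \<alpha>c) \<and>
         converges_in_distribution W (\<lambda>\<alpha> \<omega>. (sqrt (\<eta> \<alpha>) / \<sigma>H \<alpha>) * component_mean (x \<alpha> \<omega>))
           V (\<lambda>\<omega>. (1 / real CARD('n)) * (all_ones \<bullet> uH \<omega>)) (at_left \<alpha>c)"
proof -
  define c where "c = (\<lambda>\<alpha>. sqrt (\<eta> \<alpha>) / \<sigma>H \<alpha>)"
  define S :: "real ^ 'n ^ 'n"
    where "S = (\<chi> i j. Re_vec vHc $ i * Re_vec vHc $ j + Im_vec vHc $ i * Im_vec vHc $ j)"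
  have dom: "\<forall>\<^sub>F \<alpha> in at_left \<alpha>c. \<alpha> \<in> {\<alpha>0<..<\<alpha>c}"
    using range by (auto simp: eventually_at_left_field)
  have M_lim: "((\<lambda>\<alpha>. M \<alpha> $ i $ j) \<longlongrightarrow> (- jacobian (\<lambda>y. F y \<alpha>c) (at xc)) $ i $ j) (at_left \<alpha>c)" for i j
  proof -
    have "\<forall>\<^sub>F \<alpha> in at_left \<alpha>c. (xs \<alpha>, \<alpha>) \<in> U"
      using dom by eventually_elim (use smooth(2) in auto)
    from C2_on_jacobian_tendsto[OF smooth(4,3) branch_limit this]
    show ?thesis unfolding M by (auto intro: tendsto_minus)
  qed
  have uH_normal: "normal_random_vector V uH 0 S"
    using normal_random_vector_two_normals[OF V G, of "Re_vec vHc" "Im_vec vHc"]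
    unfolding S_def by (simp add: uH[symmetric])
  have S_quad: "t \<bullet> (S *v t) = (t \<bullet> Re_vec vHc)\<^sup>2 + (t \<bullet> Im_vec vHc)\<^sup>2" for t
    unfolding S_def by (rule sum_outer_product_quadratic_form)
  have cov: "((\<lambda>\<alpha>. t \<bullet> (((c \<alpha>)\<^sup>2 *\<^sub>R C \<alpha>) *v t)) \<longlongrightarrow> t \<bullet> (S *v t)) (at_left \<alpha>c)" for t
  proof (rule Lim_transform_eventually)
    show "((\<lambda>\<alpha>. \<eta> \<alpha> / (norm (complex_matrix (transpose B) *v wH \<alpha>))\<^sup>2 * (t \<bullet> (C \<alpha> *v t)))
        \<longlongrightarrow> t \<bullet> (S *v t)) (at_left \<alpha>c)"
      unfolding S_quad
    proof (rule hopf_covariance_limit[OF M_lim _ _ diag pair eta Omega gap right left _ eigenvector_limits])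
      show "\<forall>\<^sub>F \<alpha> in at_left \<alpha>c. M \<alpha> ** C \<alpha> + C \<alpha> ** transpose (M \<alpha>) = B ** transpose B"
        using dom by eventually_elim (rule lyapunov)
      \<comment> \<open>Symmetry and semidefiniteness are read off from \<open>C \<alpha>\<close>
        being the covariance of \<open>z \<alpha>\<close>.\<close>
      show "\<forall>\<^sub>F \<alpha> in at_left \<alpha>c. transpose (C \<alpha>) = C \<alpha> \<and> (\<forall>t. 0 \<le> t \<bullet> (C \<alpha> *v t))"
        using dom by eventually_elim (use z in \<open>auto simp: normal_random_vector_def\<close>)
      show "\<forall>\<^sub>F \<alpha> in at_left \<alpha>c. scalar_product (wH \<alpha>) (vH \<alpha>) = 1"
        using normalization by eventually_elim simp
    qed (use sigma_limit in \<open>simp_all only: sigma\<close>)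
    \<comment> \<open>\<open>(sqrt y)\<^sup>2\<close> is the absolute value of \<open>y\<close>, so
      positivity of \<eta> enters here.\<close>
    show "\<forall>\<^sub>F \<alpha> in at_left \<alpha>c. \<eta> \<alpha> / (norm (complex_matrix (transpose B) *v wH \<alpha>))\<^sup>2 * (t \<bullet> (C \<alpha> *v t))
        = t \<bullet> (((c \<alpha>)\<^sup>2 *\<^sub>R C \<alpha>) *v t)"
      using eta(1)
      by eventually_elim (simp add: c_def sigma power_divide scaleR_matrix_vector_assoc[symmetric])
  qed
  have c0: "(c \<longlongrightarrow> 0) (at_left \<alpha>c)"
  proof -
    \<comment> \<open>\<open>\<sigma>H \<alpha>\<close> is a norm, hence the root of its square,
      whose limit is the one assumed.\<close>
    have "((\<lambda>\<alpha>. sqrt (\<eta> \<alpha>) / sqrt ((\<sigma>H \<alpha>)\<^sup>2)) \<longlongrightarrow> sqrt 0 / sqrt (\<sigma>Hc\<^sup>2)) (at_left \<alpha>c)"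
      by (intro tendsto_intros eta sigma_limit) (use sigma_limit(2) in auto)
    then show ?thesis by (simp add: c_def sigma)
  qed
  \<comment> \<open>The deterministic shift \<open>b\<close> serves two cases: zero for the centred
    vector and \<open>c \<alpha> *\<^sub>R xs \<alpha>\<close> for the uncentred one.\<close>
  have normal: "\<forall>\<^sub>F \<alpha> in at_left \<alpha>c.
      normal_random_vector (W \<alpha>) (\<lambda>\<omega>. b \<alpha> + c \<alpha> *\<^sub>R z \<alpha> \<omega>) (b \<alpha>) ((c \<alpha>)\<^sup>2 *\<^sub>R C \<alpha>)" for b
    using dom
  proof eventually_elim
    case (elim \<alpha>)
    from normal_random_vector_affine[OF z[OF elim], of "b \<alpha>" "c \<alpha>"] show ?case by simp
  qed
  have conv: "converges_in_distribution W (\<lambda>\<alpha> \<omega>. b \<alpha> + c \<alpha> *\<^sub>R z \<alpha> \<omega>) V uH (at_left \<alpha>c)"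
    if b: "(b \<longlongrightarrow> 0) (at_left \<alpha>c)" for b
    by (rule converges_in_distribution_normal[OF normal uH_normal tendsto_inner[OF tendsto_const b] cov])
  have centred: "converges_in_distribution W (\<lambda>\<alpha> \<omega>. c \<alpha> *\<^sub>R (x \<alpha> \<omega> - xs \<alpha>)) V uH (at_left \<alpha>c)"
    using conv[OF tendsto_const] by (simp add: x)
  \<comment> \<open>Since the branch has a finite limit, its scaled mean vanishes. Hence the
    projection and the component mean can be applied to \<open>x\<close> itself, by
    continuity.\<close>
  have "((\<lambda>\<alpha>. c \<alpha> *\<^sub>R xs \<alpha>) \<longlongrightarrow> 0) (at_left \<alpha>c)"
    using tendsto_scaleR[OF c0 branch_limit] by simp
  from conv[OF this]
  have full: "converges_in_distribution W (\<lambda>\<alpha> \<omega>. c \<alpha> *\<^sub>R x \<alpha> \<omega>) V uH (at_left \<alpha>c)"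
    by (simp add: x scaleR_right_distrib)
  have "continuous_on UNIV ((*v) (centering_matrix :: real ^ 'n ^ 'n))"
    by (intro linear_continuous_on matrix_vector_mul_bounded_linear)
  from converges_in_distribution_continuous_map[OF full this]
  have proj: "converges_in_distribution W (\<lambda>\<alpha> \<omega>. c \<alpha> *\<^sub>R (centering_matrix *v x \<alpha> \<omega>))
      V (\<lambda>\<omega>. centering_matrix *v uH \<omega>) (at_left \<alpha>c)"
    by (simp add: matrix_vector_mult_scaleR)
  have "continuous_on UNIV (component_mean :: real ^ 'n \<Rightarrow> real)"
    unfolding component_mean_def by (intro continuous_intros) simp
  from converges_in_distribution_continuous_map[OF full this]
  have mean: "converges_in_distribution W (\<lambda>\<alpha> \<omega>. c \<alpha> * component_mean (x \<alpha> \<omega>))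
      V (\<lambda>\<omega>. (1 / real CARD('n)) * (all_ones \<bullet> uH \<omega>)) (at_left \<alpha>c)"
    by (simp add: component_mean_def all_ones_def inner_vec_def sum_distrib_left[symmetric])
  show ?thesis using centred proj mean unfolding c_def by blast
qed

end
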